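(* The rank of a doubly commuting submodule of $H^2(\triangle_H)$ is $1$; that is, if $\mathcal{S}$ is a doubly commuting submodule of $H^2(\triangle_H)$, then $\operatorname{rank}(\mathcal{S})=1$.
   Context: The Hartogs triangle is $\triangle_H=\{(z,w)\in\mathbb{C}^2: |z|<|w|<1\}$. The Hardy space $H^2(\triangle_H)$ is the Hilbert space of holomorphic $f$ on $\triangle_H$ with $\|f\|^2=\sup_{s,t\in(0,1)}\frac{1}{4\pi^2}\int_0^{2\pi}\int_0^{2\pi}|f(ste^{i\theta},te^{i\gamma})|^2\,st^2\,d\theta\,d\gamma<\infty$; the functions $\frac1w(\frac zw)^iw^j$, $i,j\ge0$, form an orthonormal basis. $M_z,M_w$ are multiplication by $z$ and $w$ on $H^2(\triangle_H)$. A submodule is a closed subspace $\mathcal{S}$ invariant under $M_z$ and $M_w$; put $S_z=M_z|_{\mathcal{S}}$, $S_w=M_w|_{\mathcal{S}}$. $\mathcal{S}$ is doubly commuting if $S_z^*S_w=S_wS_z^*$. For a commuting pair $T=(T_1,T_2)$ of bounded operators on a Hilbert space $\mathcal{H}$ and $E\subseteq\mathcal{H}$, let $[E]_T=\overline{\operatorname{span}}\{T_1^{k_1}T_2^{k_2}E:k_1,k_2\in\mathbb{Z}_+\}$, and $\operatorname{rank}(T)=\min\{\#E:E\subseteq\mathcal{H},\ [E]_T=\mathcal{H}\}$, where $\#E$ is the number of elements of $E$. The rank of a submodule $\mathcal{S}$ is $\operatorname{rank}(\mathcal{S})=\operatorname{rank}(S_z,S_w)$. *)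

theory Defs
  imports "HOL-Analysis.Analysis" "HOL-Library.Function_Algebras" "HOL-Library.Extended_Nat"
begin

definition hartogs_triangle :: "(complex \<times> complex) set" where
  "hartogs_triangle = {(z, w). cmod z < cmod w \<and> cmod w < 1}"

text \<open>Holomorphy in two variables (for open \<open>U\<close>): the real Frechet derivative exists at
  every point and is complex linear.\<close>

definition holomorphic2_on :: "(complex \<times> complex \<Rightarrow> complex) \<Rightarrow> (complex \<times> complex) set \<Rightarrow> bool" where
  "holomorphic2_on f U \<longleftrightarrow>
     (\<forall>p\<in>U. \<exists>a b. (f has_derivative (\<lambda>(h, k). a * h + b * k)) (at p))"

definition torus_mean :: "(complex \<times> complex \<Rightarrow> complex) \<Rightarrow> real \<Rightarrow> real \<Rightarrow> real" where
  "torus_mean f s t =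
     1 / (4 * pi\<^sup>2) *
     integral {0..2 * pi} (\<lambda>\<gamma>. integral {0..2 * pi} (\<lambda>\<theta>.
       (cmod (f (of_real (s * t) * cis \<theta>, of_real t * cis \<gamma>)))\<^sup>2 * (s * t\<^sup>2)))"

text \<open>A function on the Hartogs triangle is represented by its extension by zero to all pairs,
  so that equality in the Hardy space is equality of HOL functions.\<close>

definition hardy_space :: "(complex \<times> complex \<Rightarrow> complex) set" where
  "hardy_space =
     {f. holomorphic2_on f hartogs_triangle \<and> (\<forall>p. p \<notin> hartogs_triangle \<longrightarrow> f p = 0) \<and>
         bdd_above ((\<lambda>(s, t). torus_mean f s t) ` ({0<..<1} \<times> {0<..<1}))}"

definition hardy_norm :: "(complex \<times> complex \<Rightarrow> complex) \<Rightarrow> real" where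
  "hardy_norm f = sqrt (SUP (s, t)\<in>{0<..<1} \<times> {0<..<1}. torus_mean f s t)"

definition fun_scale :: "complex \<Rightarrow> ('a \<Rightarrow> complex) \<Rightarrow> 'a \<Rightarrow> complex" where
  "fun_scale c f = (\<lambda>p. c * f p)"

interpretation cfun: vector_space "fun_scale :: complex \<Rightarrow> ('a \<Rightarrow> complex) \<Rightarrow> 'a \<Rightarrow> complex"
  by unfold_locales (auto simp: fun_scale_def fun_eq_iff algebra_simps)

text \<open>The inner product is recovered from the Hilbert norm by polarization; it is linear in
  the first argument.\<close>

definition hardy_inner ::
    "(complex \<times> complex \<Rightarrow> complex) \<Rightarrow> (complex \<times> complex \<Rightarrow> complex) \<Rightarrow> complex" where
  "hardy_inner f g =
     (\<Sum>k<4. \<i> ^ k * of_real ((hardy_norm (f + fun_scale (\<i> ^ k) g))\<^sup>2)) / 4"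

definition hardy_closure ::
    "(complex \<times> complex \<Rightarrow> complex) set \<Rightarrow> (complex \<times> complex \<Rightarrow> complex) set" where
  "hardy_closure A = {f \<in> hardy_space. \<forall>e>0. \<exists>g\<in>A. hardy_norm (f - g) < e}"

definition mult_z :: "(complex \<times> complex \<Rightarrow> complex) \<Rightarrow> complex \<times> complex \<Rightarrow> complex" where
  "mult_z f = (\<lambda>(z, w). z * f (z, w))"

definition mult_w :: "(complex \<times> complex \<Rightarrow> complex) \<Rightarrow> complex \<times> complex \<Rightarrow> complex" where
  "mult_w f = (\<lambda>(z, w). w * f (z, w))"

definition submodule :: "(complex \<times> complex \<Rightarrow> complex) set \<Rightarrow> bool" where
  "submodule S \<longleftrightarrow>
     S \<subseteq> hardy_space \<and> cfun.subspace S \<and> hardy_closure S = S \<and>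
     mult_z ` S \<subseteq> S \<and> mult_w ` S \<subseteq> S"

text \<open>\<open>adjoint_on S T\<close> is the Hilbert space adjoint of the restriction of \<open>T\<close> to the closed
  subspace \<open>S\<close>, taken in \<open>S\<close> (not in the whole Hardy space). By the Riesz theorem the
  description is well-defined for \<open>g \<in> S\<close> when \<open>T\<close> maps \<open>S\<close> boundedly to itself; the values
  for \<open>g\<close> outside \<open>S\<close> are irrelevant.\<close>

definition adjoint_on ::
    "(complex \<times> complex \<Rightarrow> complex) set \<Rightarrow>
     ((complex \<times> complex \<Rightarrow> complex) \<Rightarrow> (complex \<times> complex \<Rightarrow> complex)) \<Rightarrow>
     (complex \<times> complex \<Rightarrow> complex) \<Rightarrow> (complex \<times> complex \<Rightarrow> complex)" where
  "adjoint_on S T g =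
     (THE h. h \<in> S \<and> (\<forall>f\<in>S. hardy_inner (T f) g = hardy_inner f h))"

definition doubly_commuting :: "(complex \<times> complex \<Rightarrow> complex) set \<Rightarrow> bool" where
  "doubly_commuting S \<longleftrightarrow>
     (\<forall>f\<in>S. adjoint_on S mult_z (mult_w f) = mult_w (adjoint_on S mult_z f))"

definition generated ::
    "((complex \<times> complex \<Rightarrow> complex) \<Rightarrow> (complex \<times> complex \<Rightarrow> complex)) \<Rightarrow>
     ((complex \<times> complex \<Rightarrow> complex) \<Rightarrow> (complex \<times> complex \<Rightarrow> complex)) \<Rightarrow>
     (complex \<times> complex \<Rightarrow> complex) set \<Rightarrow> (complex \<times> complex \<Rightarrow> complex) set" where
  "generated T1 T2 E =
     hardy_closure (cfun.span {(T1 ^^ k1) ((T2 ^^ k2) f) | k1 k2 f. f \<in> E})"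

text \<open>The rank of the pair of restrictions of \<open>T1\<close>, \<open>T2\<close> to an invariant closed subspace \<open>H\<close>,
  with values in the extended naturals. Since \<open>H\<close> generates itself, the
  infimum is an attained minimum. The empty set is allowed as a generating set; it generates
  \<open>{0}\<close>, whose rank is thus 0.\<close>

definition joint_rank ::
    "((complex \<times> complex \<Rightarrow> complex) \<Rightarrow> (complex \<times> complex \<Rightarrow> complex)) \<Rightarrow>
     ((complex \<times> complex \<Rightarrow> complex) \<Rightarrow> (complex \<times> complex \<Rightarrow> complex)) \<Rightarrow>
     (complex \<times> complex \<Rightarrow> complex) set \<Rightarrow> enat" where
  "joint_rank T1 T2 H =
     (INF E\<in>{E. E \<subseteq> H \<and> generated T1 T2 E = H}. if finite E then enat (card E) else \<infinity>)"

definition submodule_rank :: "(complex \<times> complex \<Rightarrow> complex) set \<Rightarrow> enat" where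
  "submodule_rank S = joint_rank mult_z mult_w S"

end

theory Submission
  imports Defs "HOL-Complex_Analysis.Complex_Residues"
begin

text \<open>
  In the coordinates \<open>u = z / w\<close> and \<open>w\<close> the Hartogs triangle becomes a punctured bidisc, and
  \<open>f(z, w) = g(z / w, w) / w\<close> identifies its Hardy space with the square-summable double power
  series \<open>g = \<Sum> a\<^bsub>ij\<^esub> u\<^sup>i w\<^sup>j\<close>; negative powers of \<open>w\<close> are excluded by the boundedness
  of the torus means as \<open>t\<close> tends to \<open>0\<close> (\<open>hardy_space_expansion\<close>, \<open>hardy_norm_hartogs_series\<close>).
  So the Hardy space is a complete inner product space in which multiplication by \<open>z\<close> and by \<open>w\<close> are
  the isometries that move the coefficient at \<open>(i, j)\<close> to \<open>(i + 1, j + 1)\<close> and to \<open>(i, j + 1)\<close>.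

  On a doubly commuting submodule \<open>S\<close> these two isometries form a commuting pair whose adjoints
  commute crosswise, and no nonzero vector lies in the range of all powers of either one. As in the
  Wold decomposition, every subset of \<open>S\<close> with a nonzero member that is closed under differences,
  the two isometries and their adjoints contains a nonzero wandering vector, that is, a vector killed by both
  adjoints (\<open>wandering_exists\<close>). The vectors \<open>z\<^sup>i w\<^sup>j f\<close> for a wandering \<open>f\<close> are pairwise
  orthogonal and span a reducing subspace. If there is no nonzero wandering vector orthogonal to
  \<open>f\<close>, the orthogonal complement of this subspace in \<open>S\<close> must therefore vanish, and \<open>f\<close> alone
  generates \<open>S\<close> (\<open>orbit_span_dense\<close>).

  It remains to see that two nonzero wandering vectors \<open>f\<close> and \<open>g\<close> cannot be orthogonal
  (\<open>orthogonal_orbits_impossible\<close>). Otherwise all vectors \<open>z\<^sup>k w\<^sup>l f\<close> and \<open>z\<^sup>k w\<^sup>l g\<close> form one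
  orthogonal family, to which Bessel's inequality applies. Test it on the unit vector \<open>e\<close> of the
  coefficient \<open>(K, 2 K)\<close>. For \<open>p, q < K\<close> the choice \<open>k = K - p\<close>, \<open>l = K + p - q\<close> moves the
  coefficient of \<open>f\<close> at \<open>(p, q)\<close> to \<open>(K, 2 K)\<close>, so the orbit of \<open>f\<close> contributes at least the sum of
  \<open>|a\<^bsub>pq\<^esub>|\<^sup>2\<close> over this box divided by the squared norm of \<open>f\<close>, which is close to \<open>1\<close> for large \<open>K\<close>.
  The orbit of \<open>g\<close> contributes as much, and the total exceeds the squared norm \<open>1\<close> of \<open>e\<close>.
\<close>

section \<open>Fourier series and holomorphic functions on circles\<close>

lemma M_test_integral:
  fixes f :: "nat \<Rightarrow> real \<Rightarrow> 'a::banach"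
  assumes cont: "\<And>n. continuous_on {a..b} (f n)"
    and bound: "\<And>n x. x \<in> {a..b} \<Longrightarrow> norm (f n x) \<le> M n" and M: "summable M"
  shows M_test_continuous: "continuous_on {a..b} (\<lambda>x. \<Sum>n. f n x)"
    and M_test_integral_sums:
      "(\<lambda>n. integral {a..b} (f n)) sums integral {a..b} (\<lambda>x. \<Sum>n. f n x)"
proof -
  have lim: "uniform_limit {a..b} (\<lambda>n x. \<Sum>i<n. f i x) (\<lambda>x. \<Sum>i. f i x) sequentially"
    using bound M by (rule Weierstrass_m_test)
  have cs: "continuous_on {a..b} (\<lambda>x. \<Sum>i<n. f i x)" for n
    by (intro continuous_intros cont)
  show "continuous_on {a..b} (\<lambda>x. \<Sum>n. f n x)"
    by (rule uniform_limit_theorem[OF _ lim]) (auto simp: cs)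
  obtain I J where I: "\<And>n. ((\<lambda>x. \<Sum>i<n. f i x) has_integral I n) {a..b}"
    and J: "((\<lambda>x. \<Sum>i. f i x) has_integral J) {a..b}" and lim: "I \<longlonglongrightarrow> J"
    using uniform_limit_integral[OF lim cs] by auto
  have "I n = (\<Sum>i<n. integral {a..b} (f i))" for n
  proof -
    have "((\<lambda>x. \<Sum>i<n. f i x) has_integral (\<Sum>i<n. integral {a..b} (f i))) {a..b}"
      by (intro has_integral_sum integrable_integral integrable_continuous_real cont) auto
    with I[of n] show ?thesis by (rule has_integral_unique)
  qed
  then have "I = (\<lambda>n. \<Sum>i<n. integral {a..b} (f i))" by (rule ext)
  with lim show "(\<lambda>n. integral {a..b} (f n)) sums integral {a..b} (\<lambda>x. \<Sum>n. f n x)"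
    by (simp add: sums_def integral_unique[OF J])
qed

lemma integral_cis_multiple:
  fixes k :: int
  shows "integral {0..2*pi} (\<lambda>x. cis (of_int k * x)) = (if k = 0 then 2 * of_real pi else 0)"
proof (cases "k = 0")
  case True
  then show ?thesis by (simp add: scaleR_conv_of_real)
next
  case False
  have "((\<lambda>x. cis (of_int k * x)) has_integral
      (cis (of_int k * (2*pi)) / (\<i> * of_int k) - cis (of_int k * 0) / (\<i> * of_int k))) {0..2*pi}"
  proof (rule fundamental_theorem_of_calculus)
    fix x :: real
    have "((\<lambda>x. exp (\<i> * of_int k * of_real x)) has_vector_derivative
       (\<i> * of_int k) * exp (\<i> * of_int k * of_real x)) (at x within {0..2*pi})"
      by (rule has_vector_derivative_real_field) (auto intro!: derivative_eq_intros)
    from has_vector_derivative_divide[OF this, of "\<i> * of_int k"]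
    show "((\<lambda>x. cis (of_int k * x) / (\<i> * of_int k)) has_vector_derivative cis (of_int k * x))
        (at x within {0..2*pi})"
      using False by (simp add: cis_conv_exp mult.assoc)
  qed simp
  moreover have "cis (of_int k * (2*pi)) = 1"
    by (metis cis_multiple_2pi Ints_of_int mult.commute)
  ultimately show ?thesis using False by (simp add: integral_unique)
qed

lemma fourier_series:
  fixes b :: "nat \<Rightarrow> complex"
  assumes b: "summable (\<lambda>n. cmod (b n))"
  defines "F \<equiv> \<lambda>x. \<Sum>n. b n * cis (real n * x)"
  shows fourier_series_continuous: "continuous_on {0..2*pi} F"
    and fourier_coefficient:
      "integral {0..2*pi} (\<lambda>x. F x * cis (- (real m * x))) = 2 * of_real pi * b m"
proof -
  show "continuous_on {0..2*pi} F"
    unfolding F_def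
    by (rule M_test_continuous[where M = "\<lambda>n. cmod (b n)"])
      (auto intro!: continuous_intros b simp: norm_mult)
  have s: "(\<lambda>n. integral {0..2*pi} (\<lambda>x. b n * cis (of_int (int n - int m) * x))) sums
    integral {0..2*pi} (\<lambda>x. \<Sum>n. b n * cis (of_int (int n - int m) * x))"
        by (rule M_test_integral_sums[where M = "\<lambda>n. cmod (b n)"])
      (auto intro!: continuous_intros b simp: norm_mult)
  have "(\<Sum>n. b n * cis (of_int (int n - int m) * x)) = F x * cis (- (real m * x))" for x
  proof -
    have "summable (\<lambda>n. b n * cis (real n * x))"
      by (rule summable_norm_cancel) (simp add: norm_mult b)
    from suminf_mult2[OF this, of "cis (- (real m * x))"] show ?thesis
      by (simp add: F_def mult.assoc cis_mult algebra_simps)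
  qed
  with s have "(\<lambda>n. b n * integral {0..2*pi} (\<lambda>x. cis (of_int (int n - int m) * x))) sums
     integral {0..2*pi} (\<lambda>x. F x * cis (- (real m * x)))"
    by simp
  also have "(\<lambda>n. b n * integral {0..2*pi} (\<lambda>x. cis (of_int (int n - int m) * x))) =
     (\<lambda>n. if n = m then b n * (2 * of_real pi) else 0)"
    unfolding integral_cis_multiple by auto
  finally have "(\<lambda>n. if n = m then b n * (2 * of_real pi) else 0) sums
     integral {0..2*pi} (\<lambda>x. F x * cis (- (real m * x)))" .
  from sums_unique2[OF this sums_single]
  show "integral {0..2*pi} (\<lambda>x. F x * cis (- (real m * x))) = 2 * of_real pi * b m" by simp
qed

text \<open>Expand one of the two factors of \<open>F \<cdot> cnj F\<close> and integrate termwise: each term is a Fourier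
  coefficient of the other factor.\<close>

theorem parseval_circle:
  fixes b :: "nat \<Rightarrow> complex"
  assumes b: "summable (\<lambda>n. cmod (b n))"
  shows "(\<lambda>n. 2 * pi * (cmod (b n))\<^sup>2) sums
    integral {0..2*pi} (\<lambda>x. (cmod (\<Sum>n. b n * cis (real n * x)))\<^sup>2)"
proof -
  define F where "F = (\<lambda>x. \<Sum>n. b n * cis (real n * x))"
  define I where "I = {0..2*pi}"
  have contF: "continuous_on I F"
    unfolding I_def F_def using b by (rule fourier_series_continuous)
  have coeff: "integral I (\<lambda>x. F x * cis (- (real m * x))) = 2 * of_real pi * b m" for m
    unfolding I_def F_def using b by (rule fourier_coefficient)
  obtain C where C: "\<And>x. x \<in> I \<Longrightarrow> cmod (F x) \<le> C"
    using compact_continuous_image[OF contF] unfolding I_def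
    by (metis compact_Icc compact_imp_bounded bounded_iff imageI)
  have "(\<lambda>n. integral I (\<lambda>x. b n * cis (real n * x) * cnj (F x))) sums
     integral I (\<lambda>x. \<Sum>n. b n * cis (real n * x) * cnj (F x))"
    unfolding I_def
    by (rule M_test_integral_sums[where M = "\<lambda>n. cmod (b n) * C"])
      (auto intro!: continuous_intros summable_mult2 b contF[unfolded I_def] mult_left_mono
        C[unfolded I_def] simp: norm_mult)
  moreover have "integral I (\<lambda>x. b n * cis (real n * x) * cnj (F x)) =
      of_real (2 * pi * (cmod (b n))\<^sup>2)" for n
  proof -
    have "integral I (\<lambda>x. b n * cis (real n * x) * cnj (F x)) =
       b n * integral I (\<lambda>x. cnj (F x * cis (- (real n * x))))"
      by (subst integral_mult_right[symmetric]) (simp add: cis_cnj algebra_simps)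
    also have "integral I (\<lambda>x. cnj (F x * cis (- (real n * x)))) =
       cnj (integral I (\<lambda>x. F x * cis (- (real n * x))))"
      by (rule integral_cnj[symmetric])
    finally have "integral I (\<lambda>x. b n * cis (real n * x) * cnj (F x)) = b n * cnj (2 * of_real pi * b n)"
      by (simp only: coeff)
    then show ?thesis
      by (simp add: complex_norm_square mult_ac del: of_real_power)
  qed
  moreover have "(\<Sum>n. b n * cis (real n * x) * cnj (F x)) = of_real ((cmod (F x))\<^sup>2)" for x
  proof -
    have "summable (\<lambda>n. b n * cis (real n * x))"
      by (rule summable_norm_cancel) (simp add: norm_mult b)
    from suminf_mult2[OF this, of "cnj (F x)"] show ?thesis
      by (simp add: F_def complex_norm_square del: of_real_power)
  qed
  ultimately have "(\<lambda>n. complex_of_real (2 * pi * (cmod (b n))\<^sup>2)) sums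
     integral I (\<lambda>x. of_real ((cmod (F x))\<^sup>2))"
    by simp
  also have "integral I (\<lambda>x. complex_of_real ((cmod (F x))\<^sup>2)) =
     of_real (integral I (\<lambda>x. (cmod (F x))\<^sup>2))"
    using integral_linear[OF _ bounded_linear_of_real, of "\<lambda>x. (cmod (F x))\<^sup>2" I]
    by (simp add: o_def I_def integrable_continuous_real continuous_intros contF[unfolded I_def])
  finally show ?thesis
    by (simp only: sums_of_real_iff F_def I_def)
qed

corollary parseval_power_series:
  fixes c :: "nat \<Rightarrow> complex"
  assumes "summable (\<lambda>n. cmod (c n) * r ^ n)" "0 \<le> r"
  shows "(\<lambda>n. 2 * pi * ((cmod (c n))\<^sup>2 * r ^ (2 * n))) sums
    integral {0..2*pi} (\<lambda>x. (cmod (\<Sum>n. c n * (of_real r * cis x) ^ n))\<^sup>2)"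
proof -
  have "(cmod (c n * of_real r ^ n))\<^sup>2 = (cmod (c n))\<^sup>2 * r ^ (2 * n)" for n
    by (simp add: norm_mult norm_power power_mult_distrib power_mult power2_eq_square
        \<open>0 \<le> r\<close> flip: power_mult_distrib)
  moreover have "of_real r ^ n * cis (real n * x) = (of_real r * cis x) ^ n" for n x
    by (simp add: power_mult_distrib Complex.DeMoivre)
  moreover have "summable (\<lambda>n. cmod (c n * of_real r ^ n))"
    using assms by (simp add: norm_mult norm_power)
  ultimately show ?thesis
    using parseval_circle[of "\<lambda>n. c n * of_real r ^ n"] by (simp add: mult.assoc)
qed

text \<open>Morera's theorem, with Fubini's theorem on each side of a triangle.\<close>

lemma holomorphic_on_parametric_integral:
  fixes G :: "complex \<Rightarrow> real \<Rightarrow> complex"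
  assumes "open U" and cont: "continuous_on (U \<times> {a..b}) (\<lambda>(w, x). G w x)"
    and holo: "\<And>x. x \<in> {a..b} \<Longrightarrow> (\<lambda>w. G w x) holomorphic_on U"
  shows "(\<lambda>w. integral {a..b} (G w)) holomorphic_on U"
proof -
  have c: "continuous_on U (\<lambda>w. integral {a..b} (G w))"
    using integral_continuous_on_param[of U a b G] cont by simp
  have swap: "contour_integral (linepath p q) (\<lambda>w. integral {a..b} (G w)) =
       integral {a..b} (\<lambda>x. contour_integral (linepath p q) (\<lambda>w. G w x))"
    and ii: "(\<lambda>x. contour_integral (linepath p q) (\<lambda>w. G w x)) integrable_on {a..b}"
    if seg: "closed_segment p q \<subseteq> U" for p q
  proof -
    have im: "linepath p q y \<in> U" if "y \<in> {0..1}" for y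
      using that seg by (metis imageI path_image_def path_image_linepath subsetD)
    have cl: "continuous_on ({0..1} \<times> {a..b}) (\<lambda>(y, x). G (linepath p q y) x * (q - p))"
    proof -
      have "continuous_on ({0..1} \<times> {a..b}) (\<lambda>z. (\<lambda>(w, x). G w x) (linepath p q (fst z), snd z))"
        by (rule continuous_on_compose2[OF cont])
          (use im in \<open>auto intro!: continuous_intros simp: linepath_def\<close>)
      then show ?thesis by (auto simp: case_prod_unfold intro!: continuous_intros)
    qed
    have "integral {0..1} (\<lambda>y. integral {a..b} (\<lambda>x. G (linepath p q y) x * (q - p))) =
      integral {a..b} (\<lambda>x. integral {0..1} (\<lambda>y. G (linepath p q y) x * (q - p)))"
      using integral_swap_continuous[of 0 a 1 b "\<lambda>y x. G (linepath p q y) x * (q - p)"] cl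
      by (simp add: cbox_Pair_eq)
    then show "contour_integral (linepath p q) (\<lambda>w. integral {a..b} (G w)) =
       integral {a..b} (\<lambda>x. contour_integral (linepath p q) (\<lambda>w. G w x))"
      by (simp add: contour_integral_integral)
    have "continuous_on ({a..b} \<times> {0..1}) (\<lambda>(x, y). G (linepath p q y) x * (q - p))"
      by (rule continuous_on_swap_args) (use cl in simp)
    then have "continuous_on {a..b} (\<lambda>x. integral {0..1} (\<lambda>y. G (linepath p q y) x * (q - p)))"
      using integral_continuous_on_param[of "{a..b}" 0 1 "\<lambda>x y. G (linepath p q y) x * (q - p)"]
      by simp
    then show "(\<lambda>x. contour_integral (linepath p q) (\<lambda>w. G w x)) integrable_on {a..b}"
      by (auto simp: contour_integral_integral intro: integrable_continuous_real)
  qed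
  have "(\<lambda>w. integral {a..b} (G w)) analytic_on U"
  proof (rule Morera_triangle[OF c \<open>open U\<close>], intro impI)
    fix p q r assume tri: "convex hull {p, q, r} \<subseteq> U"
    have segs: "closed_segment p q \<subseteq> U" "closed_segment q r \<subseteq> U" "closed_segment r p \<subseteq> U"
      using segments_subset_convex_hull(1,3,5)[where a = p and b = q and c = r, THEN order_trans, OF tri] by auto
    have "contour_integral (linepath p q) (\<lambda>w. G w x) + contour_integral (linepath q r) (\<lambda>w. G w x) +
        contour_integral (linepath r p) (\<lambda>w. G w x) = 0" if "x \<in> {a..b}" for x
    proof -
      have "(\<lambda>w. G w x) holomorphic_on convex hull {p, q, r}"
        using holo[OF that] tri by (rule holomorphic_on_subset)
      from has_chain_integral_chain_integral3[OF Cauchy_theorem_triangle[OF this]]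
      show ?thesis .
    qed
    then have "integral {a..b} (\<lambda>x. contour_integral (linepath p q) (\<lambda>w. G w x) +
        contour_integral (linepath q r) (\<lambda>w. G w x) + contour_integral (linepath r p) (\<lambda>w. G w x)) =
        integral {a..b} (\<lambda>x. 0)"
      by (intro integral_cong)
    then show "contour_integral (linepath p q) (\<lambda>w. integral {a..b} (G w)) +
        contour_integral (linepath q r) (\<lambda>w. integral {a..b} (G w)) +
        contour_integral (linepath r p) (\<lambda>w. integral {a..b} (G w)) = 0"
      by (simp add: swap segs integral_add ii integrable_add)
  qed
  then show ?thesis by (rule analytic_imp_holomorphic)
qed

text \<open>A removable singularity theorem with a mean-square bound in place of a pointwise one. In Cauchy's
  formula for the annulus \<open>\<epsilon> < |\<zeta>| < 1/2\<close> the integral over the inner circle is \<open>O(\<epsilon>)\<close>, because the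
  mean of \<open>|b|\<close> stays bounded there; hence the formula over the outer circle alone represents \<open>b\<close>
  and defines the value at \<open>0\<close>.\<close>

lemma holomorphic_extension_of_bounded_circle_means:
  fixes b :: "complex \<Rightarrow> complex"
  assumes holo: "b holomorphic_on ball 0 1 - {0}"
    and bound: "\<And>t. 0 < t \<Longrightarrow> t < 1 \<Longrightarrow>
      integral {0..2*pi} (\<lambda>x. (cmod (b (of_real t * cis x)))\<^sup>2) \<le> C"
  obtains B where "B holomorphic_on ball 0 1" "\<And>w. w \<in> ball 0 1 - {0} \<Longrightarrow> B w = b w"
proof -
  have contb: "continuous_on (ball 0 1 - {0}) b"
    using holo by (rule holomorphic_on_imp_continuous_on)
  have cauchy: "((\<lambda>\<zeta>. b \<zeta> / (\<zeta> - w)) has_contour_integral 2 * pi * \<i> * b w) (circlepath 0 (1/2))"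
    if w: "0 < cmod w" "cmod w < 1/2" for w
  proof -
    \<comment> \<open>The singularity of the Cauchy kernel at \<open>w\<close> is subtracted, so that the integrals of \<open>q\<close> over
      concentric circles agree although they may separate \<open>w\<close> from \<open>0\<close>.\<close>
    define q where "q = (\<lambda>\<zeta>. if \<zeta> = w then deriv b w else (b \<zeta> - b w) / (\<zeta> - w))"
    have hq: "q holomorphic_on ball 0 1 - {0}"
      unfolding q_def by (rule pole_lemma_open[OF holo]) auto
    have qint: "q contour_integrable_on circlepath 0 (1/2)"
        "q contour_integrable_on circlepath 0 \<epsilon>"
        "contour_integral (circlepath 0 (1/2)) q = contour_integral (circlepath 0 \<epsilon>) q"
      if "0 < \<epsilon>" "\<epsilon> \<le> 1/2" for \<epsilon>
    proof -
      have "cball (0::complex) (1/2) \<subseteq> ball 0 1" by auto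
      from contour_integral_circlepath_eq[OF open_ball hq that this]
      show "q contour_integrable_on circlepath 0 (1/2)" "q contour_integrable_on circlepath 0 \<epsilon>"
        "contour_integral (circlepath 0 (1/2)) q = contour_integral (circlepath 0 \<epsilon>) q" by auto
    qed
    have small: "cmod (contour_integral (circlepath 0 (1/2)) q) \<le> 2 * (2 * pi + C) / cmod w * \<epsilon>"
      if e: "0 < \<epsilon>" "\<epsilon> \<le> cmod w / 2" for \<epsilon>
    proof -
      have e1: "\<epsilon> < 1/2" "\<epsilon> < cmod w" using e w by auto
      have const: "((\<lambda>\<zeta>. b w / (\<zeta> - w)) has_contour_integral 0) (circlepath 0 \<epsilon>)"
      proof (rule Cauchy_theorem_disc_simple)
        show "(\<lambda>\<zeta>. b w / (\<zeta> - w)) holomorphic_on ball 0 (cmod w)"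
          by (intro holomorphic_intros) auto
        show "path_image (circlepath 0 \<epsilon>) \<subseteq> ball 0 (cmod w)"
          using e e1 by (auto simp: path_image_circlepath)
      qed auto
      have "((\<lambda>\<zeta>. q \<zeta> + b w / (\<zeta> - w)) has_contour_integral
          (contour_integral (circlepath 0 \<epsilon>) q + 0)) (circlepath 0 \<epsilon>)"
        using e e1 by (intro has_contour_integral_add const has_contour_integral_integral qint) auto
      then have "((\<lambda>\<zeta>. b \<zeta> / (\<zeta> - w)) has_contour_integral
          contour_integral (circlepath 0 \<epsilon>) q) (circlepath 0 \<epsilon>)"
        unfolding add_0_right
        by (rule has_contour_integral_eq)
          (use e e1 in \<open>auto simp: q_def path_image_circlepath diff_divide_distrib\<close>)
      then have hi: "((\<lambda>t. b (\<epsilon> * cis t) / (\<epsilon> * cis t - w) * \<epsilon> * \<i> * cis t) has_integral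
          contour_integral (circlepath 0 \<epsilon>) q) {0..2*pi}"
        unfolding circlepath_def by (subst (asm) has_contour_integral_part_circlepath_iff) auto
      have cc: "continuous_on {0..2*pi} (\<lambda>t. b (\<epsilon> * cis t))"
        by (rule continuous_on_compose2[OF contb])
          (use e e1 in \<open>auto intro!: continuous_intros simp: norm_mult\<close>)
      have gi: "((\<lambda>t. 2 * \<epsilon> / cmod w * (1 + (cmod (b (\<epsilon> * cis t)))\<^sup>2)) has_integral
          2 * \<epsilon> / cmod w * (2 * pi + integral {0..2*pi} (\<lambda>t. (cmod (b (\<epsilon> * cis t)))\<^sup>2))) {0..2*pi}"
        using has_integral_const_real[of "1::real" 0 "2*pi"]
        by (intro has_integral_mult_right has_integral_add integrable_integral
              integrable_continuous_real continuous_intros cc) auto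
      have "cmod (contour_integral (circlepath 0 \<epsilon>) q) \<le>
          2 * \<epsilon> / cmod w * (2 * pi + integral {0..2*pi} (\<lambda>t. (cmod (b (\<epsilon> * cis t)))\<^sup>2))"
      proof -
        \<comment> \<open>The estimate \<open>x \<le> 1 + x\<^sup>2\<close> brings in the mean square.\<close>
        have "cmod (b (\<epsilon> * cis t) / (\<epsilon> * cis t - w) * \<epsilon> * \<i> * cis t)
            \<le> 2 * \<epsilon> / cmod w * (1 + (cmod (b (\<epsilon> * cis t)))\<^sup>2)" for t
        proof -
          have "cmod w / 2 \<le> cmod (\<epsilon> * cis t - w)"
            using norm_triangle_ineq2[of w "\<epsilon> * cis t"] e by (simp add: norm_mult norm_minus_commute)
          moreover have "cmod z \<le> 1 + (cmod z)\<^sup>2" for z :: complex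
            using sum_squares_bound[of 1 "cmod z"] norm_ge_zero[of z]
            unfolding one_power2 mult_1_right by linarith
          ultimately have "cmod (b (\<epsilon> * cis t)) / cmod (\<epsilon> * cis t - w) \<le>
              (1 + (cmod (b (\<epsilon> * cis t)))\<^sup>2) / (cmod w / 2)"
            using w by (intro frac_le) auto
          from mult_right_mono[OF this, of \<epsilon>] show ?thesis
            using e by (simp add: norm_mult norm_divide field_simps)
        qed
        then have "cmod (integral {0..2*pi} (\<lambda>t. b (\<epsilon> * cis t) / (\<epsilon> * cis t - w) * \<epsilon> * \<i> * cis t))
            \<le> integral {0..2*pi} (\<lambda>t. 2 * \<epsilon> / cmod w * (1 + (cmod (b (\<epsilon> * cis t)))\<^sup>2))"
          using hi gi by (intro Henstock_Kurzweil_Integration.integral_norm_bound_integral)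
            (auto simp: has_integral_iff)
        then show ?thesis
          by (simp only: integral_unique[OF hi] integral_unique[OF gi])
      qed
      also have "\<dots> \<le> 2 * \<epsilon> / cmod w * (2 * pi + C)"
        using bound[of \<epsilon>] e e1 by (intro mult_left_mono) auto
      also have "contour_integral (circlepath 0 \<epsilon>) q = contour_integral (circlepath 0 (1/2)) q"
        using qint(3) e e1 by auto
      finally show ?thesis by (simp add: field_simps)
    qed
    have "((\<lambda>\<epsilon>. 2 * (2 * pi + C) / cmod w * \<epsilon>) \<longlongrightarrow> 2 * (2 * pi + C) / cmod w * 0) (at_right 0)"
      by (intro tendsto_intros)
    moreover have "\<forall>\<^sub>F \<epsilon> in at_right 0. cmod (contour_integral (circlepath 0 (1/2)) q) \<le>
        2 * (2 * pi + C) / cmod w * \<epsilon>"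
      using w by (intro eventually_at_rightI[of 0 "cmod w / 2"] small) auto
    ultimately have "cmod (contour_integral (circlepath 0 (1/2)) q) \<le> 2 * (2 * pi + C) / cmod w * 0"
      by (rule tendsto_lowerbound) simp
    then have q0: "contour_integral (circlepath 0 (1/2)) q = 0" by simp
    have "((\<lambda>\<zeta>. b w / (\<zeta> - w)) has_contour_integral 2 * pi * \<i> * b w) (circlepath 0 (1/2))"
      using Cauchy_integral_circlepath_simple[of "\<lambda>_. b w" 0 "1/2" w] w
      by (auto intro: holomorphic_intros)
    from has_contour_integral_add[OF has_contour_integral_integral[OF qint(1)[of "1/2"]] this]
    have "((\<lambda>\<zeta>. q \<zeta> + b w / (\<zeta> - w)) has_contour_integral 2 * pi * \<i> * b w) (circlepath 0 (1/2))"
      by (simp add: q0)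
    then show ?thesis
      by (rule has_contour_integral_eq)
        (use w in \<open>auto simp: q_def path_image_circlepath diff_divide_distrib\<close>)
  qed
  define F where "F = (\<lambda>w. contour_integral (circlepath 0 (1/2)) (\<lambda>\<zeta>. b \<zeta> / (\<zeta> - w)) / (2 * pi * \<i>))"
  have cont_circle: "continuous_on (path_image (circlepath 0 (1/2))) b"
    by (rule continuous_on_subset[OF contb]) (auto simp: path_image_circlepath)
  have Fb: "F w = b w" if "0 < cmod w" "cmod w < 1/2" for w
    using contour_integral_unique[OF cauchy[OF that]] by (simp add: F_def)
  have hF: "F holomorphic_on ball 0 (1/2)"
  proof -
    have "(\<lambda>w. contour_integral (circlepath 0 (1/2)) (\<lambda>\<zeta>. b \<zeta> / (\<zeta> - w))) field_differentiable at w"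
      if w: "w \<in> ball 0 (1/2)" for w
    proof -
      have "((\<lambda>u. b u / (u - v) ^ 1) has_contour_integral
          contour_integral (circlepath 0 (1/2)) (\<lambda>\<zeta>. b \<zeta> / (\<zeta> - v))) (circlepath 0 (1/2))"
        if "v \<in> ball 0 (1/2)" for v
      proof -
        have "(\<lambda>\<zeta>. b \<zeta> / (\<zeta> - v)) contour_integrable_on circlepath 0 (1/2)"
          by (rule contour_integrable_continuous_circlepath)
            (use that cont_circle in \<open>auto intro!: continuous_intros simp: path_image_circlepath\<close>)
        then show ?thesis by (simp add: has_contour_integral_integral)
      qed
      from Cauchy_next_derivative_circlepath(2)[OF cont_circle this _ w]
      show ?thesis by (auto simp: field_differentiable_def)
    qed
    then show ?thesis
      unfolding F_def
      by (intro holomorphic_on_divide holomorphic_on_const)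
        (auto simp: holomorphic_on_def intro: field_differentiable_at_within)
  qed
  show thesis
  proof
    let ?B = "\<lambda>w. if w = 0 then F 0 else b w"
    show "?B w = b w" if "w \<in> ball 0 1 - {0}" for w using that by auto
    have "?B holomorphic_on ball 0 (1/2)"
      by (rule holomorphic_transform[OF hF]) (auto simp: Fb)
    moreover have "?B holomorphic_on ball 0 1 - {0}"
      by (rule holomorphic_transform[OF holo]) auto
    ultimately have "?B holomorphic_on ball 0 (1/2) \<union> (ball 0 1 - {0})"
      by (rule holomorphic_on_Un) auto
    then show "?B holomorphic_on ball 0 1"
      by (rule holomorphic_on_subset) auto
  qed
qed

section \<open>Square-summable power series on the Hartogs triangle\<close>

definition square_summable :: "(nat \<times> nat \<Rightarrow> complex) \<Rightarrow> bool" where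
  "square_summable a \<longleftrightarrow> (\<lambda>p. (cmod (a p))\<^sup>2) summable_on UNIV"

definition bidisc_series :: "(nat \<times> nat \<Rightarrow> complex) \<Rightarrow> complex \<Rightarrow> complex \<Rightarrow> complex" where
  "bidisc_series a u w = (\<Sum>\<^sub>\<infinity>(i, j). a (i, j) * u ^ i * w ^ j)"

text \<open>The series in the coordinates \<open>u = z / w\<close> and \<open>w\<close>. The factor \<open>1 / w\<close> makes the monomials orthonormal:
  on the torus with radii \<open>s t\<close> and \<open>t\<close> the weight \<open>s t\<^sup>2\<close> times \<open>|1 / w|\<^sup>2\<close> is \<open>s\<close>, which tends to \<open>1\<close> at the boundary.\<close>

definition hartogs_series :: "(nat \<times> nat \<Rightarrow> complex) \<Rightarrow> complex \<times> complex \<Rightarrow> complex" where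
  "hartogs_series a = (\<lambda>(z, w).
     if (z, w) \<in> hartogs_triangle then bidisc_series a (z / w) w / w else 0)"

lemma summable_on_product_nat:
  fixes f g :: "nat \<Rightarrow> real"
  assumes "summable f" "summable g" "\<And>n. 0 \<le> f n" "\<And>n. 0 \<le> g n"
  shows "(\<lambda>(i, j). f i * g j) summable_on UNIV"
proof -
  have "(g has_sum suminf g) UNIV"
    using assms by (intro sums_nonneg_imp_has_sum) (auto simp: summable_sums)
  moreover have "(\<lambda>i. f i * suminf g) summable_on UNIV"
    using assms by (intro summable_nonneg_imp_summable_on summable_mult2) (auto simp: suminf_nonneg)
  ultimately show ?thesis
    using summable_on_SigmaI[where A = UNIV and f = "\<lambda>(i, j). f i * g j" and g = "\<lambda>i. f i * suminf g"
        and B = "\<lambda>_. UNIV"] assms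
    by (auto intro: has_sum_cmult_right)
qed

lemma iterated_series:
  fixes x :: "nat \<Rightarrow> nat \<Rightarrow> 'a :: banach"
  assumes x: "(\<lambda>(i, j). norm (x i j)) summable_on UNIV"
  shows iterated_series_inner: "summable (\<lambda>j. norm (x i j))"
    and iterated_series_norm: "summable (\<lambda>i. \<Sum>j. norm (x i j))"
    and iterated_series_sums: "(\<lambda>i. \<Sum>j. x i j) sums (\<Sum>\<^sub>\<infinity>(i, j). x i j)"
proof -
  have x': "(\<lambda>(i, j). norm (x i j)) summable_on UNIV \<times> UNIV" using x by simp
  have n: "(\<lambda>j. norm (x i j)) summable_on UNIV" for i
    using summable_on_SigmaD1[OF x'] by simp
  show s: "summable (\<lambda>j. norm (x i j))" for i
    using n by (rule summable_on_imp_summable)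
  have hn: "((\<lambda>j. norm (x i j)) has_sum (\<Sum>j. norm (x i j))) UNIV" for i
    using s by (intro sums_nonneg_imp_has_sum) (auto simp: summable_sums)
  obtain T where T: "((\<lambda>(i, j). norm (x i j)) has_sum T) (UNIV \<times> UNIV)"
    using x' by (auto simp: summable_on_def)
  have "((\<lambda>i. \<Sum>j. norm (x i j)) has_sum T) UNIV"
    by (rule has_sum_SigmaD[OF T]) (simp add: hn)
  then show "summable (\<lambda>i. \<Sum>j. norm (x i j))"
    by (intro sums_summable[OF has_sum_imp_sums])
  have "(\<lambda>(i, j). x i j) summable_on UNIV"
    by (rule Infinite_Sum.abs_summable_summable) (use x in \<open>simp add: case_prod_unfold\<close>)
  then have X: "((\<lambda>(i, j). x i j) has_sum (\<Sum>\<^sub>\<infinity>(i, j). x i j)) (UNIV \<times> UNIV)"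
    by simp
  have "((\<lambda>j. x i j) has_sum (\<Sum>j. x i j)) UNIV" for i
    by (rule norm_summable_imp_has_sum[OF s]) (rule summable_sums[OF summable_norm_cancel[OF s]])
  then have "((\<lambda>i. \<Sum>j. x i j) has_sum (\<Sum>\<^sub>\<infinity>(i, j). x i j)) UNIV"
    by (intro has_sum_SigmaD[OF X]) simp
  then show "(\<lambda>i. \<Sum>j. x i j) sums (\<Sum>\<^sub>\<infinity>(i, j). x i j)"
    by (rule has_sum_imp_sums)
qed

lemma square_summable_bounded:
  assumes "square_summable a"
  obtains C where "C \<ge> 0" "\<And>p. cmod (a p) \<le> C"
proof
  let ?C = "sqrt (\<Sum>\<^sub>\<infinity>p. (cmod (a p))\<^sup>2)"
  show "?C \<ge> 0" by (simp add: infsum_nonneg)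
  show "cmod (a p) \<le> ?C" for p
    using finite_sum_le_infsum[of "\<lambda>p. (cmod (a p))\<^sup>2" UNIV "{p}"] assms
    by (intro real_le_rsqrt) (auto simp: square_summable_def)
qed

lemma bidisc_series_abs_summable:
  assumes a: "square_summable a" and "cmod u < 1" "cmod w < 1"
  shows "(\<lambda>(i, j). norm (a (i, j) * u ^ i * w ^ j)) summable_on UNIV"
proof -
  obtain C where C: "C \<ge> 0" "\<And>p. cmod (a p) \<le> C" using square_summable_bounded[OF a] by blast
  have "(\<lambda>(i, j). (C * cmod u ^ i) * cmod w ^ j) summable_on UNIV"
    using assms C by (intro summable_on_product_nat summable_mult) (auto simp: summable_geometric)
  then show ?thesis
    by (rule summable_on_comparison_test)
      (auto simp: norm_mult norm_power intro!: mult_right_mono C)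
qed

text \<open>On the circle of radius \<open>s t\<close> the point \<open>u = z / w\<close> has argument \<open>\<theta> - \<gamma>\<close>. The rotation by \<open>\<gamma>\<close> is
  absorbed into the coefficients, whose absolute values it does not change, so Parseval's identity
  applies to the integral in \<open>\<theta>\<close> without a change of variables.\<close>

lemma circle_mean_of_slice:
  assumes st: "0 < s" "s < 1" "0 < t" and w: "w = of_real t * cis \<gamma>"
    and series: "\<And>u. cmod u < 1 \<Longrightarrow> (\<lambda>i. b i * u ^ i) sums (w * f (u * w, w))"
  shows "(\<lambda>i. 2 * pi * s * ((cmod (b i))\<^sup>2 * s ^ (2 * i))) sums
    integral {0..2*pi} (\<lambda>\<theta>. (cmod (f (of_real (s * t) * cis \<theta>, w)))\<^sup>2 * (s * t\<^sup>2))"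
proof -
  have w0: "cmod w = t" "w \<noteq> 0" using st w by (auto simp: norm_mult)
  define r where "r = (1 + s) / 2"
  have r: "s < r" "r < 1" using st by (auto simp: r_def)
  have "summable (\<lambda>i. b i * of_real r ^ i)"
    using series[of "of_real r"] r st by (auto simp: sums_iff)
  from powser_insidea[OF this, of "of_real s"]
  have sm: "summable (\<lambda>i. cmod (b i * cis (- (real i * \<gamma>))) * s ^ i)"
    using r st by (simp add: norm_mult norm_power)
  have "(cmod (f (of_real (s * t) * cis \<theta>, w)))\<^sup>2 * (s * t\<^sup>2) =
      s * (cmod (\<Sum>i. b i * cis (- (real i * \<gamma>)) * (of_real s * cis \<theta>) ^ i))\<^sup>2" for \<theta>
  proof -
    define u where "u = of_real s * cis (\<theta> - \<gamma>)"
    have "u * w = of_real (s * t) * cis \<theta>"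
      by (simp add: u_def w cis_mult)
    moreover have "cmod u < 1" using st by (simp add: u_def norm_mult)
    moreover have "u ^ i = cis (- (real i * \<gamma>)) * (of_real s * cis \<theta>) ^ i" for i
      by (simp add: u_def power_mult_distrib Complex.DeMoivre cis_mult algebra_simps)
    ultimately have "(\<Sum>i. b i * cis (- (real i * \<gamma>)) * (of_real s * cis \<theta>) ^ i) =
        w * f (of_real (s * t) * cis \<theta>, w)"
      using series[of u] by (simp add: sums_iff mult.assoc)
    then show ?thesis by (simp add: norm_mult w0 power_mult_distrib)
  qed
  then have "integral {0..2*pi} (\<lambda>\<theta>. (cmod (f (of_real (s * t) * cis \<theta>, w)))\<^sup>2 * (s * t\<^sup>2)) =
      s * integral {0..2*pi} (\<lambda>\<theta>. (cmod (\<Sum>i. b i * cis (- (real i * \<gamma>)) * (of_real s * cis \<theta>) ^ i))\<^sup>2)"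
    by (simp only: integral_mult_right)
  moreover have "s * (2 * pi * ((cmod (b i * cis (- (real i * \<gamma>))))\<^sup>2 * s ^ (2 * i))) =
      2 * pi * s * ((cmod (b i))\<^sup>2 * s ^ (2 * i))" for i
    by (simp add: norm_mult)
  moreover have "(\<lambda>i. s * (2 * pi * ((cmod (b i * cis (- (real i * \<gamma>))))\<^sup>2 * s ^ (2 * i)))) sums
      (s * integral {0..2*pi} (\<lambda>\<theta>. (cmod (\<Sum>i. b i * cis (- (real i * \<gamma>)) * (of_real s * cis \<theta>) ^ i))\<^sup>2))"
    by (rule sums_mult[OF parseval_power_series[OF sm]]) (use st in simp)
  ultimately show ?thesis by (simp only:)
qed

lemma bidisc_series_iterated:
  assumes "square_summable a" "cmod u < 1" "cmod w < 1"
  shows "(\<lambda>i. (\<Sum>j. a (i, j) * w ^ j) * u ^ i) sums bidisc_series a u w"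
proof -
  have "(\<Sum>j. a (i, j) * u ^ i * w ^ j) = (\<Sum>j. a (i, j) * w ^ j) * u ^ i" if "u \<noteq> 0 \<or> i = 0" for i
  proof -
    have "summable (\<lambda>j. a (i, j) * u ^ i * w ^ j)"
      using iterated_series_inner[OF bidisc_series_abs_summable[OF assms]]
      by (rule summable_norm_cancel)
    from summable_mult2[OF this, of "inverse (u ^ i)"] have "summable (\<lambda>j. a (i, j) * w ^ j)"
      using that by (cases "i = 0") (auto simp: field_simps)
    from suminf_mult2[OF this, of "u ^ i"] show ?thesis by (simp add: mult_ac)
  qed
  moreover have "(\<Sum>j. a (i, j) * u ^ i * w ^ j) = (\<Sum>j. a (i, j) * w ^ j) * u ^ i"
    if "\<not> (u \<noteq> 0 \<or> i = 0)" for i using that by (simp add: power_0_left)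
  ultimately have "(\<Sum>j. a (i, j) * u ^ i * w ^ j) = (\<Sum>j. a (i, j) * w ^ j) * u ^ i" for i
    by blast
  then show ?thesis
    using iterated_series_sums[OF bidisc_series_abs_summable[OF assms]]
    by (simp add: bidisc_series_def)
qed

text \<open>Parseval's identity is used twice: first on the slice of fixed \<open>w\<close>, whose coefficients are
  power series \<open>B\<^sub>i(w)\<close>, and then on the circle \<open>|w| = t\<close> for each \<open>B\<^sub>i\<close>.\<close>

lemma torus_mean_hartogs_series:
  assumes a: "square_summable a" and st: "0 < s" "s < 1" "0 < t" "t < 1"
  shows "torus_mean (hartogs_series a) s t =
    s * (\<Sum>\<^sub>\<infinity>(i, j). (cmod (a (i, j)))\<^sup>2 * s ^ (2 * i) * t ^ (2 * j))"
proof -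
  define B where "B = (\<lambda>i w. \<Sum>j. a (i, j) * w ^ j)"
  define M where "M = (\<lambda>i. \<Sum>j. cmod (a (i, j)) * t ^ j)"
  have abs: "(\<lambda>(i, j). norm (a (i, j) * of_real s ^ i * of_real t ^ j)) summable_on UNIV"
    using st by (intro bidisc_series_abs_summable[OF a]) auto
  have row: "summable (\<lambda>j. cmod (a (i, j)) * t ^ j)" for i
    using summable_mult2[OF iterated_series_inner[OF abs, of i], of "inverse (s ^ i)"] st
    by (simp add: norm_mult norm_power field_simps)
  have M0: "0 \<le> M i" for i
    unfolding M_def by (intro suminf_nonneg row) (use st in auto)
  have MS: "summable (\<lambda>i. M i * s ^ i)"
  proof -
    have "(\<Sum>j. norm (a (i, j) * of_real s ^ i * of_real t ^ j)) = M i * s ^ i" for i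
      using suminf_mult2[OF row[of i], of "s ^ i"] st
      by (simp add: M_def norm_mult norm_power mult_ac)
    then show ?thesis using iterated_series_norm[OF abs] by simp
  qed
  have BM: "cmod (B i (of_real t * cis \<gamma>)) \<le> M i" for i \<gamma>
  proof -
    have "cmod (B i (of_real t * cis \<gamma>)) \<le> (\<Sum>j. norm (a (i, j) * (of_real t * cis \<gamma>) ^ j))"
      unfolding B_def by (rule summable_norm) (use row st in \<open>simp add: norm_mult norm_power\<close>)
    then show ?thesis using st by (simp add: M_def norm_mult norm_power)
  qed
  have Bcont: "continuous_on {0..2*pi} (\<lambda>\<gamma>. B i (of_real t * cis \<gamma>))" for i
    using fourier_series_continuous[of "\<lambda>j. a (i, j) * of_real t ^ j"] row[of i] st
    by (simp add: B_def norm_mult norm_power power_mult_distrib Complex.DeMoivre mult.assoc)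
  have inner: "(\<Sum>i. 2 * pi * s * ((cmod (B i (of_real t * cis \<gamma>)))\<^sup>2 * s ^ (2 * i))) =
      integral {0..2*pi} (\<lambda>\<theta>. (cmod (hartogs_series a
        (of_real (s * t) * cis \<theta>, of_real t * cis \<gamma>)))\<^sup>2 * (s * t\<^sup>2))" for \<gamma>
  proof (rule sums_unique[symmetric], rule circle_mean_of_slice[OF st(1-3) refl])
    fix u :: complex assume u: "cmod u < 1"
    let ?w = "of_real t * cis \<gamma>"
    have w: "cmod ?w = t" "?w \<noteq> 0" using st by (auto simp: norm_mult)
    have "(u * ?w, ?w) \<in> hartogs_triangle"
      using u st w by (simp add: hartogs_triangle_def norm_mult)
    then have "?w * hartogs_series a (u * ?w, ?w) = bidisc_series a u ?w"
      using st by (simp add: hartogs_series_def)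
    then show "(\<lambda>i. B i ?w * u ^ i) sums (?w * hartogs_series a (u * ?w, ?w))"
      using bidisc_series_iterated[OF a u, of ?w] w st by (simp add: B_def)
  qed
  have outer: "(\<lambda>i. integral {0..2*pi} (\<lambda>\<gamma>. 2 * pi * s * ((cmod (B i (of_real t * cis \<gamma>)))\<^sup>2 * s ^ (2 * i))))
      sums integral {0..2*pi} (\<lambda>\<gamma>. \<Sum>i. 2 * pi * s * ((cmod (B i (of_real t * cis \<gamma>)))\<^sup>2 * s ^ (2 * i)))"
  proof (rule M_test_integral_sums)
    show "continuous_on {0..2*pi} (\<lambda>\<gamma>. 2 * pi * s * ((cmod (B i (of_real t * cis \<gamma>)))\<^sup>2 * s ^ (2 * i)))" for i
      by (intro continuous_intros Bcont)
    show "norm (2 * pi * s * ((cmod (B i (of_real t * cis \<gamma>)))\<^sup>2 * s ^ (2 * i))) \<le>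
        2 * pi * s * (M i * s ^ i)\<^sup>2" for i \<gamma>
    proof -
      have "(cmod (B i (of_real t * cis \<gamma>)))\<^sup>2 \<le> (M i)\<^sup>2"
        by (intro power_mono BM) auto
      then show ?thesis using st
        by (auto simp: norm_mult power_mult_distrib abs_mult power_mult mult.commute[of 2] intro!: mult_mono)
    qed
    show "summable (\<lambda>i. 2 * pi * s * (M i * s ^ i)\<^sup>2)"
    proof (intro summable_mult)
      have "(\<lambda>i. M i * s ^ i) \<longlonglongrightarrow> 0" using MS by (rule summable_LIMSEQ_zero)
      then have "\<forall>\<^sub>F i in sequentially. M i * s ^ i < 1" by (rule order_tendstoD) simp
      then have "\<forall>\<^sub>F i in sequentially. norm ((M i * s ^ i)\<^sup>2) \<le> M i * s ^ i"
        by eventually_elim (use M0 st in \<open>auto simp: power2_eq_square intro!: mult_left_le_one_le mult_right_le_one_le\<close>)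
      then show "summable (\<lambda>i. (M i * s ^ i)\<^sup>2)"
        using MS by (rule summable_comparison_test_ev)
    qed
  qed
  have row_mean: "integral {0..2*pi} (\<lambda>\<gamma>. 2 * pi * s * ((cmod (B i (of_real t * cis \<gamma>)))\<^sup>2 * s ^ (2 * i))) =
      4 * pi\<^sup>2 * s * (\<Sum>j. (cmod (a (i, j)))\<^sup>2 * s ^ (2 * i) * t ^ (2 * j))" for i
  proof -
    have P: "(\<lambda>j. 2 * pi * ((cmod (a (i, j)))\<^sup>2 * t ^ (2 * j))) sums
        integral {0..2*pi} (\<lambda>\<gamma>. (cmod (B i (of_real t * cis \<gamma>)))\<^sup>2)"
      unfolding B_def using row[of i] st by (intro parseval_power_series) auto
    have "integral {0..2*pi} (\<lambda>\<gamma>. 2 * pi * s * ((cmod (B i (of_real t * cis \<gamma>)))\<^sup>2 * s ^ (2 * i))) =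
        2 * pi * s * s ^ (2 * i) * integral {0..2*pi} (\<lambda>\<gamma>. (cmod (B i (of_real t * cis \<gamma>)))\<^sup>2)"
      by (subst integral_mult_right[symmetric]) (simp add: mult_ac)
    also have "\<dots> = (\<Sum>j. 2 * pi * s * s ^ (2 * i) * (2 * pi * ((cmod (a (i, j)))\<^sup>2 * t ^ (2 * j))))"
      using sums_unique[OF sums_mult[OF P]] by simp
    also have "\<dots> = (\<Sum>j. 4 * pi\<^sup>2 * s * ((cmod (a (i, j)))\<^sup>2 * s ^ (2 * i) * t ^ (2 * j)))"
      by (simp add: power2_eq_square mult_ac)
    also have "\<dots> = 4 * pi\<^sup>2 * s * (\<Sum>j. (cmod (a (i, j)))\<^sup>2 * s ^ (2 * i) * t ^ (2 * j))"
    proof (rule suminf_mult)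
      from summable_mult[OF sums_summable[OF P], of "s ^ (2 * i) / (2 * pi)"]
      show "summable (\<lambda>j. (cmod (a (i, j)))\<^sup>2 * s ^ (2 * i) * t ^ (2 * j))"
        by (simp add: mult_ac)
    qed
    finally show ?thesis .
  qed
  have "(\<lambda>(i, j). norm ((cmod (a (i, j)))\<^sup>2 * s ^ (2 * i) * t ^ (2 * j))) summable_on UNIV"
  proof -
    have "(\<lambda>p. (cmod (a p))\<^sup>2) summable_on UNIV" using a by (simp add: square_summable_def)
    then show ?thesis
    proof (rule summable_on_comparison_test)
      fix p :: "nat \<times> nat"
      have "s ^ n * t ^ m \<le> 1 * 1" for n m
        using st by (intro mult_mono power_le_one) auto
      then show "(case p of (i, j) \<Rightarrow> norm ((cmod (a (i, j)))\<^sup>2 * s ^ (2 * i) * t ^ (2 * j))) \<le> (cmod (a p))\<^sup>2"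
        using st by (cases p) (auto simp: abs_mult mult.assoc intro!: mult_right_le_one_le)
    qed (auto split: prod.split)
  qed
  from sums_mult[OF iterated_series_sums[OF this], of "4 * pi\<^sup>2 * s"]
  have "4 * pi\<^sup>2 * s * (\<Sum>\<^sub>\<infinity>(i, j). (cmod (a (i, j)))\<^sup>2 * s ^ (2 * i) * t ^ (2 * j)) =
     integral {0..2*pi} (\<lambda>\<gamma>. \<Sum>i. 2 * pi * s * ((cmod (B i (of_real t * cis \<gamma>)))\<^sup>2 * s ^ (2 * i)))"
    by (rule sums_unique2) (rule outer[unfolded row_mean])
  then show ?thesis
    unfolding torus_mean_def inner[symmetric] by (simp add: field_simps)
qed

text \<open>The finite sums in the torus means are polynomials in \<open>s\<close>, so a bound for \<open>s < 1\<close> persists at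
  \<open>s = 1\<close>.\<close>

lemma boundary_limit_finite_sum:
  fixes x :: "nat \<times> nat \<Rightarrow> real"
  assumes "\<And>s. 0 < s \<Longrightarrow> s < 1 \<Longrightarrow> s * (\<Sum>(i, j)\<in>F. x (i, j) * s ^ (2 * i) * s ^ (2 * j)) \<le> C"
  shows "(\<Sum>p\<in>F. x p) \<le> C"
proof -
  let ?g = "\<lambda>s::real. s * (\<Sum>(i, j)\<in>F. x (i, j) * s ^ (2 * i) * s ^ (2 * j))"
  have "isCont ?g 1"
    by (auto simp: case_prod_unfold intro!: continuous_intros)
  then have "(?g \<longlongrightarrow> ?g 1) (at_left 1)"
    unfolding isCont_def by (rule filterlim_mono) (auto intro: at_le)
  moreover have "\<forall>\<^sub>F s in at_left 1. ?g s \<le> C"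
    using assms by (intro eventually_at_leftI[of 0]) auto
  ultimately have "?g 1 \<le> C"
    by (rule tendsto_upperbound) simp
  then show ?thesis by (simp add: case_prod_unfold)
qed

lemma torus_mean_hartogs_series_le:
  assumes a: "square_summable a" and st: "0 < s" "s < 1" "0 < t" "t < 1"
  shows "torus_mean (hartogs_series a) s t \<le> (\<Sum>\<^sub>\<infinity>p. (cmod (a p))\<^sup>2)"
    and finite_sum_le_torus_mean: "finite F \<Longrightarrow>
      s * (\<Sum>(i, j)\<in>F. (cmod (a (i, j)))\<^sup>2 * s ^ (2 * i) * t ^ (2 * j)) \<le>
        torus_mean (hartogs_series a) s t"
proof -
  have sa: "(\<lambda>p. (cmod (a p))\<^sup>2) summable_on UNIV" using a by (simp add: square_summable_def)
  have le: "(case p of (i, j) \<Rightarrow> (cmod (a (i, j)))\<^sup>2 * s ^ (2 * i) * t ^ (2 * j)) \<le> (cmod (a p))\<^sup>2" for p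
  proof -
    have "s ^ n * t ^ m \<le> 1 * 1" for n m
      using st by (intro mult_mono power_le_one) auto
    then show ?thesis
      using st by (cases p) (auto simp: mult.assoc intro!: mult_right_le_one_le)
  qed
  have sw: "(\<lambda>(i, j). (cmod (a (i, j)))\<^sup>2 * s ^ (2 * i) * t ^ (2 * j)) summable_on UNIV"
    using sa by (rule summable_on_comparison_test) (use le st in \<open>auto split: prod.split\<close>)
  have "(\<Sum>\<^sub>\<infinity>(i, j). (cmod (a (i, j)))\<^sup>2 * s ^ (2 * i) * t ^ (2 * j)) \<le> (\<Sum>\<^sub>\<infinity>p. (cmod (a p))\<^sup>2)"
    using sw sa by (rule infsum_mono) (rule le)
  moreover have "0 \<le> (\<Sum>\<^sub>\<infinity>(i, j). (cmod (a (i, j)))\<^sup>2 * s ^ (2 * i) * t ^ (2 * j))"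
    by (rule infsum_nonneg) (use st in auto)
  ultimately show "torus_mean (hartogs_series a) s t \<le> (\<Sum>\<^sub>\<infinity>p. (cmod (a p))\<^sup>2)"
    unfolding torus_mean_hartogs_series[OF assms]
    using st by (meson mult_left_le_one_le order_trans less_imp_le)
  show "s * (\<Sum>(i, j)\<in>F. (cmod (a (i, j)))\<^sup>2 * s ^ (2 * i) * t ^ (2 * j)) \<le>
        torus_mean (hartogs_series a) s t" if "finite F"
    unfolding torus_mean_hartogs_series[OF assms]
    using st that by (intro mult_left_mono finite_sum_le_infsum sw) auto
qed

theorem hardy_norm_hartogs_series:
  assumes a: "square_summable a"
  shows "hardy_norm (hartogs_series a) = sqrt (\<Sum>\<^sub>\<infinity>p. (cmod (a p))\<^sup>2)"
    and hartogs_series_bdd: "bdd_above ((\<lambda>(s, t). torus_mean (hartogs_series a) s t) ` ({0<..<1} \<times> {0<..<1}))"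
proof -
  let ?A = "(\<lambda>(s, t). torus_mean (hartogs_series a) s t) ` ({0<..<1} \<times> {0<..<1})"
  show bdd: "bdd_above ?A"
    using torus_mean_hartogs_series_le(1)[OF a] by (auto intro!: bdd_aboveI)
  have sa: "(\<lambda>p. (cmod (a p))\<^sup>2) summable_on UNIV" using a by (simp add: square_summable_def)
  have "?A \<noteq> {}" by (auto simp: image_iff intro!: exI[of _ "1/2"])
  then have "Sup ?A \<le> (\<Sum>\<^sub>\<infinity>p. (cmod (a p))\<^sup>2)"
    using torus_mean_hartogs_series_le(1)[OF a] by (intro cSup_least) auto
  moreover have "(\<Sum>\<^sub>\<infinity>p. (cmod (a p))\<^sup>2) \<le> Sup ?A"
  proof (rule infsum_le_finite_sums[OF sa])
    fix F :: "(nat \<times> nat) set" assume F: "finite F"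
    show "(\<Sum>p\<in>F. (cmod (a p))\<^sup>2) \<le> Sup ?A"
    proof (rule boundary_limit_finite_sum)
      fix s :: real assume s: "0 < s" "s < 1"
      have "torus_mean (hartogs_series a) s s \<le> Sup ?A"
        using s by (intro cSup_upper bdd) auto
      with finite_sum_le_torus_mean[OF a s s F]
      show "s * (\<Sum>(i, j)\<in>F. (cmod (a (i, j)))\<^sup>2 * s ^ (2 * i) * s ^ (2 * j)) \<le> Sup ?A"
        by (rule order_trans)
    qed
  qed
  ultimately have "Sup ?A = (\<Sum>\<^sub>\<infinity>p. (cmod (a p))\<^sup>2)" by (rule antisym)
  then show "hardy_norm (hartogs_series a) = sqrt (\<Sum>\<^sub>\<infinity>p. (cmod (a p))\<^sup>2)"
    by (simp add: hardy_norm_def)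
qed

text \<open>Enumerating the pairs turns a sum over \<open>\<nat> \<times> \<nat>\<close> into a series, to which the theorem on termwise
  differentiation applies.\<close>

lemma abs_summable_prod_decode:
  fixes x :: "nat \<times> nat \<Rightarrow> 'a :: banach"
  assumes "(\<lambda>p. norm (x p)) summable_on UNIV"
  shows "summable (\<lambda>n. norm (x (prod_decode n)))"
    and "(\<lambda>n. x (prod_decode n)) sums (\<Sum>\<^sub>\<infinity>p. x p)"
proof -
  show "summable (\<lambda>n. norm (x (prod_decode n)))"
    using summable_on_reindex_bij_betw[OF bij_prod_decode, of "\<lambda>p. norm (x p)"] assms
    by (intro summable_on_imp_summable) simp
  have "(x has_sum (\<Sum>\<^sub>\<infinity>p. x p)) UNIV"
    using Infinite_Sum.abs_summable_summable[OF assms] by simp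
  then show "(\<lambda>n. x (prod_decode n)) sums (\<Sum>\<^sub>\<infinity>p. x p)"
    using has_sum_reindex_bij_betw[OF bij_prod_decode, of x] by (intro has_sum_imp_sums) simp
qed

text \<open>Termwise differentiation: on a smaller bidisc of radius \<open>r\<close> the partial derivatives \<open>P\<close> and \<open>Q\<close> of the
  monomials are dominated by summable products of geometric series and their derivatives.\<close>

lemma bidisc_series_has_derivative:
  assumes a: "square_summable a" and uw: "cmod u < 1" "cmod w < 1"
  shows "\<exists>A B. ((\<lambda>(u, w). bidisc_series a u w) has_derivative (\<lambda>(h, k). A * h + B * k)) (at (u, w))"
proof -
  obtain C where C: "C \<ge> 0" "\<And>p. cmod (a p) \<le> C" using square_summable_bounded[OF a] by blast
  obtain r where "max (cmod u) (cmod w) < r" "r < 1"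
    using dense[of "max (cmod u) (cmod w)" 1] uw by auto
  then have r: "cmod u < r" "cmod w < r" "0 < r" "r < 1"
    using norm_ge_zero[of u] by linarith+
  define S where "S = ball (0::complex) r \<times> ball (0::complex) r"
  define d where "d = prod_decode"
  define P Q :: "nat \<Rightarrow> complex \<times> complex \<Rightarrow> complex" where
    "P n = (\<lambda>(u, w). a (d n) * (of_nat (fst (d n)) * u ^ (fst (d n) - 1)) * w ^ snd (d n))" and
    "Q n = (\<lambda>(u, w). u ^ fst (d n) * (a (d n) * (of_nat (snd (d n)) * w ^ (snd (d n) - 1))))" for n
  define f :: "nat \<Rightarrow> complex \<times> complex \<Rightarrow> complex" where
    "f n = (\<lambda>(u, w). a (d n) * u ^ fst (d n) * w ^ snd (d n))" for n
  have "summable (\<lambda>i. real (Suc i) * r ^ i)"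
    using geometric_deriv_sums[of r] r by (intro sums_summable) auto
  then have "summable (\<lambda>i. real i * r ^ (i - 1))"
    by (subst summable_Suc_iff[symmetric]) simp
  then have geo: "summable (\<lambda>i. r ^ i)" "summable (\<lambda>i. C * (real i * r ^ (i - 1)))"
    using r by (auto intro!: summable_mult simp: summable_geometric)
  have MP: "summable (\<lambda>n. C * (real (fst (d n)) * r ^ (fst (d n) - 1)) * r ^ snd (d n))"
    using abs_summable_prod_decode(1)[of "\<lambda>(i, j). C * (real i * r ^ (i - 1)) * r ^ j"]
      summable_on_product_nat[OF geo(2,1)] C r
    by (simp add: case_prod_unfold d_def abs_mult)
  have MQ: "summable (\<lambda>n. r ^ fst (d n) * (C * (real (snd (d n)) * r ^ (snd (d n) - 1))))"
    using abs_summable_prod_decode(1)[of "\<lambda>(i, j). r ^ i * (C * (real j * r ^ (j - 1)))"]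
      summable_on_product_nat[OF geo(1,2)] C r
    by (simp add: case_prod_unfold d_def abs_mult)
  have Cd: "cmod (a (d n)) \<le> C" for n by (rule C)
  have up: "uniform_limit S (\<lambda>n x. \<Sum>i<n. P i x) (\<lambda>x. \<Sum>i. P i x) sequentially"
    using _ MP by (rule Weierstrass_m_test)
      (use C(1) Cd r in \<open>auto simp: P_def S_def norm_mult norm_power intro!: mult_mono power_mono\<close>)
  have uq: "uniform_limit S (\<lambda>n x. \<Sum>i<n. Q i x) (\<lambda>x. \<Sum>i. Q i x) sequentially"
    using _ MQ by (rule Weierstrass_m_test)
      (use C(1) Cd r in \<open>auto simp: Q_def S_def norm_mult norm_power intro!: mult_mono power_mono\<close>)
  have f_sums: "(\<lambda>n. f n x) sums (case x of (u, w) \<Rightarrow> bidisc_series a u w)" if "x \<in> S" for x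
  proof -
    obtain v y where x: "x = (v, y)" by fastforce
    then have "cmod v < 1" "cmod y < 1" using that r by (auto simp: S_def)
    from abs_summable_prod_decode(2)[of "\<lambda>(i, j). a (i, j) * v ^ i * y ^ j"]
      bidisc_series_abs_summable[OF a this]
    show ?thesis by (simp add: f_def x d_def bidisc_series_def case_prod_unfold)
  qed
  have "\<exists>g. \<forall>x\<in>S. (\<lambda>n. f n x) sums g x \<and>
      (g has_derivative (\<lambda>(h, k). (\<Sum>i. P i x) * h + (\<Sum>i. Q i x) * k)) (at x within S)"
  proof (rule has_derivative_series[where f' = "\<lambda>n x (h, k). P n x * h + Q n x * k" and x = "(u, w)"])
    show "convex S" unfolding S_def by (intro convex_Times convex_ball)
    show "(f n has_derivative (\<lambda>(h, k). P n x * h + Q n x * k)) (at x within S)" for n x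
      unfolding f_def P_def Q_def case_prod_unfold
      by (auto intro!: derivative_eq_intros simp: fun_eq_iff algebra_simps)
    show "(u, w) \<in> S" using r by (auto simp: S_def)
    then show "(\<lambda>n. f n (u, w)) sums bidisc_series a u w" using f_sums[of "(u, w)"] by simp
    fix e :: real assume "e > 0"
    then have "\<forall>\<^sub>F n in sequentially. \<forall>x\<in>S. dist (\<Sum>i<n. P i x) (\<Sum>i. P i x) < e / 2"
      and "\<forall>\<^sub>F n in sequentially. \<forall>x\<in>S. dist (\<Sum>i<n. Q i x) (\<Sum>i. Q i x) < e / 2"
      using uniform_limitD[OF up, of "e / 2"] uniform_limitD[OF uq, of "e / 2"] by auto
    then show "\<forall>\<^sub>F n in sequentially. \<forall>x\<in>S. \<forall>h. norm ((\<Sum>i<n. (\<lambda>(h, k). P i x * h + Q i x * k) h) -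
        (case h of (h, k) \<Rightarrow> (\<Sum>i. P i x) * h + (\<Sum>i. Q i x) * k)) \<le> e * norm h"
    proof eventually_elim
      case (elim n)
      show ?case
      proof (intro ballI allI)
        fix x and hk :: "complex \<times> complex" assume x: "x \<in> S"
        obtain h k where hk: "hk = (h, k)" by fastforce
        have "norm ((\<Sum>i<n. P i x * h + Q i x * k) - ((\<Sum>i. P i x) * h + (\<Sum>i. Q i x) * k)) =
            norm (((\<Sum>i<n. P i x) - (\<Sum>i. P i x)) * h + ((\<Sum>i<n. Q i x) - (\<Sum>i. Q i x)) * k)"
          by (simp add: sum.distrib flip: sum_distrib_right) (simp add: algebra_simps)
        also have "\<dots> \<le> e / 2 * norm hk + e / 2 * norm hk"
        proof (rule order_trans[OF norm_triangle_ineq add_mono])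
          have "norm ((\<Sum>i<n. P i x) - (\<Sum>i. P i x)) \<le> e / 2" "norm ((\<Sum>i<n. Q i x) - (\<Sum>i. Q i x)) \<le> e / 2"
            using elim x by (metis dist_norm less_imp_le)+
          then show "norm (((\<Sum>i<n. P i x) - (\<Sum>i. P i x)) * h) \<le> e / 2 * norm hk"
            "norm (((\<Sum>i<n. Q i x) - (\<Sum>i. Q i x)) * k) \<le> e / 2 * norm hk"
            using norm_fst_le[of h k] norm_snd_le[of k h] \<open>e > 0\<close>
            unfolding norm_mult hk by (intro mult_mono; simp)+
        qed
        finally show "norm ((\<Sum>i<n. (\<lambda>(h, k). P i x * h + Q i x * k) hk) -
          (case hk of (h, k) \<Rightarrow> (\<Sum>i. P i x) * h + (\<Sum>i. Q i x) * k)) \<le> e * norm hk"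
          by (simp add: hk)
      qed
    qed
  qed
  then obtain g where g: "\<And>x. x \<in> S \<Longrightarrow> (\<lambda>n. f n x) sums g x"
    "\<And>x. x \<in> S \<Longrightarrow> (g has_derivative (\<lambda>(h, k). (\<Sum>i. P i x) * h + (\<Sum>i. Q i x) * k)) (at x within S)"
    by blast
  have S: "open S" "(u, w) \<in> S" using r by (auto simp: S_def intro!: open_Times)
  have "((\<lambda>(u, w). bidisc_series a u w) has_derivative
      (\<lambda>(h, k). (\<Sum>i. P i (u, w)) * h + (\<Sum>i. Q i (u, w)) * k)) (at (u, w))"
  proof (rule has_derivative_transform_within_open[OF _ S])
    show "(g has_derivative (\<lambda>(h, k). (\<Sum>i. P i (u, w)) * h + (\<Sum>i. Q i (u, w)) * k)) (at (u, w))"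
      using g(2)[OF S(2)] at_within_open[OF S(2,1)] by simp
    show "g x = (case x of (u, w) \<Rightarrow> bidisc_series a u w)" if "x \<in> S" for x
      using sums_unique2[OF g(1)[OF that] f_sums[OF that]] .
  qed
  then show ?thesis by blast
qed

lemma open_hartogs_triangle: "open hartogs_triangle"
proof -
  have eq: "hartogs_triangle = {p. cmod (fst p) < cmod (snd p)} \<inter> {p. cmod (snd p) < 1}"
    by (auto simp: hartogs_triangle_def)
  show ?thesis
    unfolding eq by (intro open_Int open_Collect_less continuous_intros)
qed

lemma hartogs_series_holomorphic:
  assumes a: "square_summable a"
  shows "holomorphic2_on (hartogs_series a) hartogs_triangle"
  unfolding holomorphic2_on_def
proof
  fix p assume p: "p \<in> hartogs_triangle"
  obtain z w where zw: "p = (z, w)" by fastforce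
  have w: "cmod z < cmod w" "cmod w < 1" "w \<noteq> 0" using p by (auto simp: zw hartogs_triangle_def)
  then have "cmod (z / w) < 1" by (simp add: norm_divide)
  from bidisc_series_has_derivative[OF a this w(2)] obtain A B where
    AB: "((\<lambda>(u, w). bidisc_series a u w) has_derivative (\<lambda>(h, k). A * h + B * k)) (at (z / w, w))" by blast
  have "((\<lambda>p. (fst p / snd p, snd p)) has_derivative
      (\<lambda>hk. ((fst hk * w - z * snd hk) / (w * w), snd hk))) (at (z, w))"
    using w by (auto intro!: derivative_eq_intros simp: field_simps)
  from has_derivative_compose[OF this, of "\<lambda>p. bidisc_series a (fst p) (snd p)"
      "\<lambda>hk. A * fst hk + B * snd hk"] AB
  have "((\<lambda>p. bidisc_series a (fst p / snd p) (snd p)) has_derivative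
      (\<lambda>hk. A * ((fst hk * w - z * snd hk) / (w * w)) + B * snd hk)) (at (z, w))"
    unfolding case_prod_unfold by simp
  then have D: "((\<lambda>p. bidisc_series a (fst p / snd p) (snd p) / snd p) has_derivative
      (\<lambda>(h, k). (A / (w * w)) * h + ((B - A * z / (w * w)) / w - bidisc_series a (z / w) w / (w * w)) * k)) (at (z, w))"
    by (rule has_derivative_eq_rhs[OF has_derivative_divide'[OF _ has_derivative_snd[OF has_derivative_ident]]])
      (use w in \<open>auto simp: fun_eq_iff field_simps\<close>)
  have "(hartogs_series a has_derivative
      (\<lambda>(h, k). (A / (w * w)) * h + ((B - A * z / (w * w)) / w - bidisc_series a (z / w) w / (w * w)) * k)) (at (z, w))"
    by (rule has_derivative_transform_within_open[OF D open_hartogs_triangle])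
      (use p in \<open>auto simp: zw hartogs_series_def\<close>)
  then show "\<exists>a' b'. (hartogs_series a has_derivative (\<lambda>(h, k). a' * h + b' * k)) (at p)"
    unfolding zw by blast
qed

theorem hartogs_series_in_hardy_space:
  assumes "square_summable a"
  shows "hartogs_series a \<in> hardy_space"
  using hartogs_series_holomorphic[OF assms] hartogs_series_bdd[OF assms]
  by (auto simp: hardy_space_def hartogs_series_def)

section \<open>Power series expansion of Hardy space functions\<close>

lemma finite_subset_box:
  fixes F :: "(nat \<times> nat) set"
  assumes "finite F"
  obtains n where "F \<subseteq> {..<n} \<times> {..<n}"
proof -
  obtain m n where "fst ` F \<subseteq> {..<m}" "snd ` F \<subseteq> {..<n}"
    using finite_nat_bounded assms finite_imageI by metis
  then have "F \<subseteq> {..<max m n} \<times> {..<max m n}" by (force simp: less_max_iff_disj)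
  then show thesis by (rule that)
qed

text \<open>On each slice of fixed \<open>w\<close> the function \<open>g(u, w) = w f(u w, w)\<close> is a power series in \<open>u\<close> with
  coefficients \<open>\<beta>\<^sub>i(w)\<close>, which are holomorphic for \<open>0 < |w| < 1\<close>. By Parseval's identity on
  the slices, the torus means of \<open>f\<close> bound the means of \<open>|\<beta>\<^sub>i|\<^sup>2\<close> over all circles around \<open>0\<close>. So \<open>\<beta>\<^sub>i\<close> has a
  removable singularity at \<open>0\<close>, and its Taylor coefficients form the \<open>i\<close>-th row of \<open>a\<close>.\<close>

theorem hardy_space_expansion:
  assumes f: "f \<in> hardy_space"
  obtains a where "square_summable a" "f = hartogs_series a"
proof -
  have der: "\<exists>A B. (f has_derivative (\<lambda>(h, k). A * h + B * k)) (at p)" if "p \<in> hartogs_triangle" for p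
    using f that by (auto simp: hardy_space_def holomorphic2_on_def)
  have contf: "continuous_on hartogs_triangle f"
    using der by (meson continuous_at_imp_continuous_on has_derivative_continuous)
  obtain C where C: "torus_mean f s t \<le> C" if "0 < s" "s < 1" "0 < t" "t < 1" for s t
    using f by (fastforce simp: hardy_space_def bdd_above_def)
  have inH: "(u * w, w) \<in> hartogs_triangle" if "cmod u < 1" "0 < cmod w" "cmod w < 1" for u w
    using that by (simp add: hartogs_triangle_def norm_mult)
  define g where "g = (\<lambda>u w. w * f (u * w, w))"
  have gu: "(\<lambda>u. g u w) holomorphic_on ball 0 1" if w: "0 < cmod w" "cmod w < 1" for w
  proof -
    have "(\<lambda>u. f (u * w, w)) field_differentiable at u" if u: "cmod u < 1" for u
    proof -
      obtain A B where AB: "(f has_derivative (\<lambda>(h, k). A * h + B * k)) (at (u * w, w))"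
        using der[OF inH[OF u w]] by blast
      have "((\<lambda>u. (u * w, w)) has_derivative (\<lambda>h. (h * w, 0))) (at u)"
        by (auto intro!: derivative_eq_intros)
      from has_derivative_compose[OF this AB]
      have "((\<lambda>u. f (u * w, w)) has_field_derivative A * w) (at u)"
        unfolding has_field_derivative_def by (rule has_derivative_eq_rhs) (auto simp: fun_eq_iff)
      then show ?thesis by (auto simp: field_differentiable_def)
    qed
    then show ?thesis
      unfolding g_def by (intro holomorphic_on_mult holomorphic_on_const)
        (auto simp: holomorphic_on_def intro: field_differentiable_at_within)
  qed
  have gw: "(\<lambda>w. g u w) holomorphic_on ball 0 1 - {0}" if u: "cmod u < 1" for u
  proof -
    have "(\<lambda>w. f (u * w, w)) field_differentiable at w" if w: "0 < cmod w" "cmod w < 1" for w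
    proof -
      obtain A B where AB: "(f has_derivative (\<lambda>(h, k). A * h + B * k)) (at (u * w, w))"
        using der[OF inH[OF u w]] by blast
      have "((\<lambda>w. (u * w, w)) has_derivative (\<lambda>h. (u * h, h))) (at w)"
        by (auto intro!: derivative_eq_intros)
      from has_derivative_compose[OF this AB]
      have "((\<lambda>w. f (u * w, w)) has_field_derivative A * u + B) (at w)"
        unfolding has_field_derivative_def
        by (rule has_derivative_eq_rhs) (auto simp: fun_eq_iff algebra_simps)
      then show ?thesis by (auto simp: field_differentiable_def)
    qed
    then show ?thesis
      unfolding g_def by (intro holomorphic_on_mult holomorphic_on_ident)
        (auto simp: holomorphic_on_def intro: field_differentiable_at_within)
  qed
  \<comment> \<open>The coefficient is recovered from the circle \<open>|u| = 1/2\<close>; as an integral over a parameter it is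
    holomorphic in \<open>w\<close>.\<close>
  define \<beta> where "\<beta> = (\<lambda>(i::nat) w. integral {0..2*pi}
      (\<lambda>x. g (of_real (1/2) * cis x) w * cis (- (real i * x))) * (2 ^ i / (2 * of_real pi)))"
  have h\<beta>: "\<beta> i holomorphic_on ball 0 1 - {0}" for i
    unfolding \<beta>_def
  proof (rule holomorphic_on_mult[OF holomorphic_on_parametric_integral holomorphic_on_const])
    show "open (ball (0::complex) 1 - {0})" by auto
    have "continuous_on ((ball 0 1 - {0}) \<times> {0..2*pi})
        (\<lambda>p. f (of_real (1/2) * cis (snd p) * fst p, fst p))"
      by (rule continuous_on_compose2[OF contf])
        (auto intro!: continuous_intros simp: norm_mult norm_divide hartogs_triangle_def)
    then show "continuous_on ((ball 0 1 - {0}) \<times> {0..2*pi})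
        (\<lambda>(w, x). g (of_real (1/2) * cis x) w * cis (- (real i * x)))"
      by (auto simp: g_def case_prod_unfold intro!: continuous_intros)
    show "(\<lambda>w. g (of_real (1/2) * cis x) w * cis (- (real i * x))) holomorphic_on ball 0 1 - {0}" for x
      by (intro holomorphic_on_mult holomorphic_on_const gw) (simp add: norm_mult)
  qed
  have slice: "(\<lambda>i. \<beta> i w * u ^ i) sums (w * f (u * w, w))"
    if w: "0 < cmod w" "cmod w < 1" and u: "cmod u < 1" for u w
  proof -
    define c where "c = (\<lambda>i. (deriv ^^ i) (\<lambda>u. g u w) 0 / fact i)"
    have c: "(\<lambda>i. c i * v ^ i) sums g v w" if "cmod v < 1" for v
      using holomorphic_power_series[OF gu[OF w], of v] that by (simp add: c_def)
    \<comment> \<open>Convergence at the larger radius \<open>3/4\<close> gives absolute convergence at \<open>1/2\<close>.\<close>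
    have "summable (\<lambda>i. c i * of_real (3/4) ^ i)" using c[of "of_real (3/4)"] by (simp add: sums_iff)
    from powser_insidea[OF this, of "of_real (1/2)"]
    have "summable (\<lambda>i. cmod (c i * of_real (1/2) ^ i))" by simp
    from fourier_coefficient[OF this]
    have *: "integral {0..2*pi} (\<lambda>x. (\<Sum>n. c n * of_real (1/2) ^ n * cis (real n * x)) * cis (- (real m * x))) =
      2 * of_real pi * (c m * of_real (1/2) ^ m)" for m .
    have "(\<Sum>n. c n * of_real (1/2) ^ n * cis (real n * x)) = g (of_real (1/2) * cis x) w" for x
    proof -
      have "of_real (1/2) ^ n * cis (real n * x) = (of_real (1/2) * cis x) ^ n" for n
        by (simp only: power_mult_distrib Complex.DeMoivre)
      then show ?thesis
        using c[of "of_real (1/2) * cis x"] by (simp only: mult.assoc sums_iff) (simp add: norm_mult)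
    qed
    with * have "\<beta> i w = c i" for i
      by (simp add: \<beta>_def power_divide)
    with c[OF u] show ?thesis by (simp add: g_def)
  qed
  have circ: "0 < cmod (of_real t * cis \<gamma>)" "cmod (of_real t * cis \<gamma>) < 1" if "0 < t" "t < 1" for t \<gamma>
    using that by (auto simp: norm_mult)
  have \<beta>cont: "continuous_on {0..2*pi} (\<lambda>\<gamma>. \<beta> i (of_real t * cis \<gamma>))" if "0 < t" "t < 1" for i t
    by (rule continuous_on_compose2[OF holomorphic_on_imp_continuous_on[OF h\<beta>]])
      (use that circ in \<open>auto intro!: continuous_intros\<close>)
  have bound: "(\<Sum>i<n. s * s ^ (2 * i) * integral {0..2*pi} (\<lambda>\<gamma>. (cmod (\<beta> i (of_real t * cis \<gamma>)))\<^sup>2)) \<le> 2 * pi * C"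
    if st: "0 < s" "s < 1" "0 < t" "t < 1" for s t n
  proof -
    define \<Phi> where "\<Phi> = (\<lambda>\<gamma>. integral {0..2*pi}
       (\<lambda>\<theta>. (cmod (f (of_real (s * t) * cis \<theta>, of_real t * cis \<gamma>)))\<^sup>2 * (s * t\<^sup>2)))"
    have "continuous_on ({0..2*pi} \<times> {0..2*pi})
        (\<lambda>p. f (of_real (s * t) * cis (snd p), of_real t * cis (fst p)))"
      by (rule continuous_on_compose2[OF contf])
        (use st in \<open>auto intro!: continuous_intros simp: norm_mult hartogs_triangle_def\<close>)
    then have "continuous_on {0..2*pi} \<Phi>"
      unfolding \<Phi>_def
      by (intro integral_continuous_on_param[where a = 0 and b = "2*pi", simplified])
        (auto simp: case_prod_unfold intro!: continuous_intros)
    then have i\<Phi>: "\<Phi> integrable_on {0..2*pi}" by (rule integrable_continuous_real)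
    have "(\<Sum>i<n. 2 * pi * s * ((cmod (\<beta> i (of_real t * cis \<gamma>)))\<^sup>2 * s ^ (2 * i))) \<le> \<Phi> \<gamma>" for \<gamma>
    proof -
      have "(\<lambda>i. 2 * pi * s * ((cmod (\<beta> i (of_real t * cis \<gamma>)))\<^sup>2 * s ^ (2 * i))) sums \<Phi> \<gamma>"
        unfolding \<Phi>_def using st circ by (intro circle_mean_of_slice[where \<gamma> = \<gamma>] slice) auto
      then show ?thesis
        using sum_le_suminf[of "\<lambda>i. 2 * pi * s * ((cmod (\<beta> i (of_real t * cis \<gamma>)))\<^sup>2 * s ^ (2 * i))" "{..<n}"] st
        by (simp add: sums_iff)
    qed
    then have "integral {0..2*pi} (\<lambda>\<gamma>. \<Sum>i<n. 2 * pi * s * ((cmod (\<beta> i (of_real t * cis \<gamma>)))\<^sup>2 * s ^ (2 * i))) \<le> integral {0..2*pi} \<Phi>"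
      by (intro integral_le i\<Phi> integrable_continuous_real continuous_intros \<beta>cont st) auto
    also have "integral {0..2*pi} \<Phi> = 4 * pi\<^sup>2 * torus_mean f s t"
      by (simp add: torus_mean_def \<Phi>_def)
    also have "\<dots> \<le> 4 * pi\<^sup>2 * C" using C[OF st] by (intro mult_left_mono) auto
    also have "integral {0..2*pi} (\<lambda>\<gamma>. \<Sum>i<n. 2 * pi * s * ((cmod (\<beta> i (of_real t * cis \<gamma>)))\<^sup>2 * s ^ (2 * i))) =
        (\<Sum>i<n. 2 * pi * s * (integral {0..2*pi} (\<lambda>\<gamma>. (cmod (\<beta> i (of_real t * cis \<gamma>)))\<^sup>2) * s ^ (2 * i)))"
      by (subst integral_sum) (auto intro!: integrable_continuous_real continuous_intros \<beta>cont st)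
    also have "\<dots> = 2 * pi * (\<Sum>i<n. s * s ^ (2 * i) * integral {0..2*pi} (\<lambda>\<gamma>. (cmod (\<beta> i (of_real t * cis \<gamma>)))\<^sup>2))"
      by (simp add: sum_distrib_left mult_ac)
    finally show ?thesis by (simp add: power2_eq_square field_simps)
  qed
  \<comment> \<open>One term of the preceding bound, at \<open>s = 1/2\<close>.\<close>
  have mean: "integral {0..2*pi} (\<lambda>\<gamma>. (cmod (\<beta> i (of_real t * cis \<gamma>)))\<^sup>2) \<le> 2 * pi * C / ((1/2) * (1/2) ^ (2 * i))"
    if t: "0 < t" "t < 1" for i t
  proof -
    have "(1/2) * (1/2) ^ (2 * i) * integral {0..2*pi} (\<lambda>\<gamma>. (cmod (\<beta> i (of_real t * cis \<gamma>)))\<^sup>2) \<le>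
       (\<Sum>i<Suc i. (1/2) * (1/2) ^ (2 * i) * integral {0..2*pi} (\<lambda>\<gamma>. (cmod (\<beta> i (of_real t * cis \<gamma>)))\<^sup>2))"
      by (rule member_le_sum)
        (auto intro!: mult_nonneg_nonneg integral_nonneg integrable_continuous_real continuous_intros \<beta>cont t)
    also have "\<dots> \<le> 2 * pi * C" using t by (intro bound) auto
    finally show ?thesis by (simp add: field_simps)
  qed
  have "\<exists>B. B holomorphic_on ball 0 1 \<and> (\<forall>w\<in>ball 0 1 - {0}. B w = \<beta> i w)" for i
    using holomorphic_extension_of_bounded_circle_means[OF h\<beta> mean] by metis
  then obtain B where B: "\<And>i. B i holomorphic_on ball 0 1"
    "\<And>i w. w \<in> ball 0 1 - {0} \<Longrightarrow> B i w = \<beta> i w" by metis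
  define a where "a = (\<lambda>(i, j). (deriv ^^ j) (B i) 0 / fact j)"
  have a\<beta>: "(\<lambda>j. a (i, j) * w ^ j) sums \<beta> i w" if "0 < cmod w" "cmod w < 1" for i w
    using holomorphic_power_series[OF B(1)[of i], of w] B(2)[of w i] that by (simp add: a_def)
  have row: "(\<Sum>j<n. (cmod (a (i, j)))\<^sup>2 * t ^ (2 * j)) \<le>
      integral {0..2*pi} (\<lambda>\<gamma>. (cmod (\<beta> i (of_real t * cis \<gamma>)))\<^sup>2) / (2 * pi)"
    if t: "0 < t" "t < 1" for i n t
  proof -
    obtain r where r: "t < r" "r < 1" using dense[OF t(2)] by blast
    then have "summable (\<lambda>j. a (i, j) * of_real r ^ j)"
      using a\<beta>[of "of_real r" i] t by (auto simp: sums_iff)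
    from powser_insidea[OF this, of "of_real t"]
    have "summable (\<lambda>j. cmod (a (i, j)) * t ^ j)" using r t by (simp add: norm_mult norm_power)
    from parseval_power_series[OF this]
    have "(\<lambda>j. 2 * pi * ((cmod (a (i, j)))\<^sup>2 * t ^ (2 * j))) sums
        integral {0..2*pi} (\<lambda>\<gamma>. (cmod (\<beta> i (of_real t * cis \<gamma>)))\<^sup>2)"
      using t sums_unique[OF a\<beta>[OF circ[OF t]]] by simp
    then have "(\<Sum>j<n. 2 * pi * ((cmod (a (i, j)))\<^sup>2 * t ^ (2 * j))) \<le>
        integral {0..2*pi} (\<lambda>\<gamma>. (cmod (\<beta> i (of_real t * cis \<gamma>)))\<^sup>2)"
      using sum_le_suminf[of "\<lambda>j. 2 * pi * ((cmod (a (i, j)))\<^sup>2 * t ^ (2 * j))" "{..<n}"] t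
      by (simp add: sums_iff)
    then show ?thesis by (simp add: field_simps sum_distrib_left)
  qed
  have box: "(\<Sum>p\<in>{..<n} \<times> {..<n}. (cmod (a p))\<^sup>2) \<le> C" for n
  proof (rule boundary_limit_finite_sum)
    fix s :: real assume s: "0 < s" "s < 1"
    have "s * (\<Sum>(i, j)\<in>{..<n} \<times> {..<n}. (cmod (a (i, j)))\<^sup>2 * s ^ (2 * i) * s ^ (2 * j)) =
        (\<Sum>i<n. s * s ^ (2 * i) * (\<Sum>j<n. (cmod (a (i, j)))\<^sup>2 * s ^ (2 * j)))"
      by (simp add: sum.cartesian_product[symmetric] sum_distrib_left mult_ac)
    also have "\<dots> \<le> (\<Sum>i<n. s * s ^ (2 * i) *
        (integral {0..2*pi} (\<lambda>\<gamma>. (cmod (\<beta> i (of_real s * cis \<gamma>)))\<^sup>2) / (2 * pi)))"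
      using s by (intro sum_mono mult_left_mono row) auto
    also have "\<dots> \<le> C"
      using bound[OF s s, of n] by (simp add: field_simps flip: sum_divide_distrib)
    finally show "s * (\<Sum>(i, j)\<in>{..<n} \<times> {..<n}. (cmod (a (i, j)))\<^sup>2 * s ^ (2 * i) * s ^ (2 * j)) \<le> C" .
  qed
  have sa: "square_summable a"
    unfolding square_summable_def
  proof (rule nonneg_bdd_above_summable_on)
    have "(\<Sum>p\<in>F. (cmod (a p))\<^sup>2) \<le> C" if F: "finite F" for F
    proof -
      obtain n where F: "F \<subseteq> {..<n} \<times> {..<n}" using finite_subset_box[OF F] by blast
      have "(\<Sum>p\<in>F. (cmod (a p))\<^sup>2) \<le> (\<Sum>p\<in>{..<n} \<times> {..<n}. (cmod (a p))\<^sup>2)"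
        using F by (intro sum_mono2) auto
      also note box
      finally show ?thesis .
    qed
    then show "bdd_above (sum (\<lambda>p. (cmod (a p))\<^sup>2) ` {F. F \<subseteq> UNIV \<and> finite F})"
      by (auto intro!: bdd_aboveI[of _ C])
  qed auto
  moreover have "f = hartogs_series a"
  proof
    fix p :: "complex \<times> complex"
    obtain z w where p: "p = (z, w)" by fastforce
    show "f p = hartogs_series a p"
    proof (cases "p \<in> hartogs_triangle")
      case False
      then show ?thesis using f by (simp add: hardy_space_def hartogs_series_def p)
    next
      case True
      then have w: "0 < cmod w" "cmod w < 1" "w \<noteq> 0"
        by (auto simp: p hartogs_triangle_def intro: le_less_trans[OF norm_ge_zero])
      then have u: "cmod (z / w) < 1"
        using True by (simp add: p hartogs_triangle_def norm_divide)
      have "(\<lambda>i. \<beta> i w * (z / w) ^ i) sums bidisc_series a (z / w) w"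
        using bidisc_series_iterated[OF sa u w(2)] sums_unique[OF a\<beta>[OF w(1,2)]] by simp
      from sums_unique2[OF this slice[OF w(1,2) u]]
      show ?thesis using True w by (simp add: p hartogs_series_def)
    qed
  qed
  ultimately show thesis by (rule that)
qed

section \<open>Hilbert spaces of complex functions\<close>

text \<open>From here on functions are treated as vectors. Pointwise evaluation as a simplification rule would turn
  vectors such as \<open>0\<close> and \<open>x - y\<close> into abstractions, which the rules about vectors no longer match.\<close>

declare zero_fun_apply [simp del] plus_fun_apply [simp del] minus_apply [simp del] uminus_apply [simp del]

lemma diff_eq_add_scale: "x - y = x + fun_scale (-1) (y :: 'a \<Rightarrow> complex)"
  by (simp add: fun_eq_iff fun_scale_def plus_fun_apply minus_apply)

lemma tendsto_zero_of_cmod_square: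
  assumes "((\<lambda>n. (cmod (f n))\<^sup>2) \<longlongrightarrow> 0) F"
  shows "(f \<longlongrightarrow> 0) F"
proof (rule tendsto_norm_zero_cancel)
  show "((\<lambda>n. cmod (f n)) \<longlongrightarrow> 0) F"
    using tendsto_real_sqrt[OF assms] by simp
qed

text \<open>A Hilbert space whose vectors are the functions in \<open>H\<close> with pointwise operations. The inner product
  is constrained only on \<open>H\<close>, so that the same inner product serves for a space and its closed subspaces.\<close>

locale function_hilbert =
  fixes H :: "('a \<Rightarrow> complex) set" and ip :: "('a \<Rightarrow> complex) \<Rightarrow> ('a \<Rightarrow> complex) \<Rightarrow> complex"
  assumes subspace: "cfun.subspace H"
    and ip_add_left: "\<lbrakk>x \<in> H; y \<in> H; z \<in> H\<rbrakk> \<Longrightarrow> ip (x + y) z = ip x z + ip y z"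
    and ip_scale_left: "\<lbrakk>x \<in> H; y \<in> H\<rbrakk> \<Longrightarrow> ip (fun_scale c x) y = c * ip x y"
    and ip_commute: "\<lbrakk>x \<in> H; y \<in> H\<rbrakk> \<Longrightarrow> ip y x = cnj (ip x y)"
    and ip_self_nonneg: "x \<in> H \<Longrightarrow> 0 \<le> Re (ip x x)"
    and ip_definite: "\<lbrakk>x \<in> H; Re (ip x x) = 0\<rbrakk> \<Longrightarrow> x = 0"
    and complete: "\<lbrakk>\<And>n. X n \<in> H;
        \<And>e. 0 < e \<Longrightarrow> \<exists>N. \<forall>m\<ge>N. \<forall>n\<ge>N. Re (ip (X m - X n) (X m - X n)) < e\<rbrakk> \<Longrightarrow>
      \<exists>x\<in>H. (\<lambda>n. Re (ip (X n - x) (X n - x))) \<longlonglongrightarrow> 0"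
begin

definition nsq :: "('a \<Rightarrow> complex) \<Rightarrow> real" where
  "nsq x = Re (ip x x)"

lemma add_mem: "x \<in> H \<Longrightarrow> y \<in> H \<Longrightarrow> x + y \<in> H"
  and scale_mem: "x \<in> H \<Longrightarrow> fun_scale c x \<in> H"
  and zero_mem: "0 \<in> H"
  using subspace by (auto simp: cfun.subspace_def)

lemma diff_mem: "x \<in> H \<Longrightarrow> y \<in> H \<Longrightarrow> x - y \<in> H"
  unfolding diff_eq_add_scale by (intro add_mem scale_mem)

lemma ip_diff_left: "\<lbrakk>x \<in> H; y \<in> H; z \<in> H\<rbrakk> \<Longrightarrow> ip (x - y) z = ip x z - ip y z"
  unfolding diff_eq_add_scale[of x y]
  by (simp only: ip_add_left ip_scale_left scale_mem) simp

lemma ip_add_right: "\<lbrakk>x \<in> H; y \<in> H; z \<in> H\<rbrakk> \<Longrightarrow> ip z (x + y) = ip z x + ip z y"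
  by (metis add_mem complex_cnj_add ip_add_left ip_commute)

lemma ip_diff_right: "\<lbrakk>x \<in> H; y \<in> H; z \<in> H\<rbrakk> \<Longrightarrow> ip z (x - y) = ip z x - ip z y"
  by (metis diff_mem complex_cnj_diff ip_diff_left ip_commute)

lemma ip_scale_right: "\<lbrakk>x \<in> H; y \<in> H\<rbrakk> \<Longrightarrow> ip y (fun_scale c x) = cnj c * ip y x"
  by (metis scale_mem complex_cnj_mult ip_scale_left ip_commute)

lemma ip_zero_left: "x \<in> H \<Longrightarrow> ip 0 x = 0"
  using ip_diff_left[of x x x] by simp

lemma ip_self: "x \<in> H \<Longrightarrow> ip x x = of_real (nsq x)"
  using ip_commute[of x x] by (simp add: nsq_def complex_eq_iff)

lemma nsq_nonneg: "x \<in> H \<Longrightarrow> 0 \<le> nsq x"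
  by (simp add: nsq_def ip_self_nonneg)

lemma nsq_pos: "x \<in> H \<Longrightarrow> x \<noteq> 0 \<Longrightarrow> 0 < nsq x"
  using ip_definite ip_self_nonneg by (fastforce simp: nsq_def less_le)

lemma nsq_diff: "\<lbrakk>x \<in> H; y \<in> H\<rbrakk> \<Longrightarrow> nsq (x - y) = nsq x + nsq y - 2 * Re (ip x y)"
  using ip_commute[of x y] by (simp add: nsq_def ip_diff_left ip_diff_right diff_mem)

lemma nsq_add: "\<lbrakk>x \<in> H; y \<in> H\<rbrakk> \<Longrightarrow> nsq (x + y) = nsq x + nsq y + 2 * Re (ip x y)"
  using ip_commute[of x y] by (simp add: nsq_def ip_add_left ip_add_right add_mem)

lemma nsq_scale:
  assumes "x \<in> H"
  shows "nsq (fun_scale c x) = (cmod c)\<^sup>2 * nsq x"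
proof -
  have "ip (fun_scale c x) (fun_scale c x) = (c * cnj c) * ip x x"
    using assms by (simp add: ip_scale_left ip_scale_right scale_mem)
  also have "\<dots> = of_real ((cmod c)\<^sup>2 * nsq x)"
    using assms by (simp only: complex_norm_square[symmetric] ip_self of_real_mult)
  finally show ?thesis by (simp only: nsq_def Re_complex_of_real)
qed

lemma nsq_commute: "x \<in> H \<Longrightarrow> y \<in> H \<Longrightarrow> nsq (x - y) = nsq (y - x)"
  using ip_commute[of x y] by (simp add: nsq_diff)

lemma eq_by_ip:
  assumes "x \<in> H" "y \<in> H" "\<And>z. z \<in> H \<Longrightarrow> ip z x = ip z y"
  shows "x = y"
proof -
  have "nsq (x - y) = 0"
    using assms by (simp add: nsq_def ip_diff_right diff_mem)
  then show ?thesis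
    using nsq_pos[of "x - y"] assms diff_mem by fastforce
qed

text \<open>Moving \<open>y\<close> towards its projection on \<open>m\<close> reduces the squared norm. The denominator
  \<open>nsq m + 1\<close> instead of \<open>nsq m\<close> avoids the case \<open>m = 0\<close> and costs only a constant in the
  resulting weak form of the Cauchy-Schwarz inequality.\<close>

lemma nsq_reduce:
  assumes "y \<in> H" "m \<in> H"
  shows "nsq (y - fun_scale (ip y m / (nsq m + 1)) m) \<le> nsq y - (cmod (ip y m))\<^sup>2 / (nsq m + 1)"
proof -
  let ?N = "nsq m" and ?c = "ip y m / (nsq m + 1)"
  have N: "0 \<le> ?N" using assms nsq_nonneg by blast
  have "ip y (fun_scale ?c m) = cnj ?c * ip y m"
    using assms by (intro ip_scale_right)
  also have "\<dots> = of_real ((cmod (ip y m))\<^sup>2) / (of_real ?N + 1)"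
    by (simp add: complex_norm_square mult.commute del: of_real_power)
  also have "\<dots> = of_real ((cmod (ip y m))\<^sup>2 / (?N + 1))"
    by (simp only: of_real_divide of_real_add of_real_1)
  finally have "Re (ip y (fun_scale ?c m)) = (cmod (ip y m))\<^sup>2 / (?N + 1)"
    by (simp only: Re_complex_of_real)
  moreover have "(cmod ?c)\<^sup>2 * ?N \<le> (cmod (ip y m))\<^sup>2 / (?N + 1)"
  proof -
    have "cmod (complex_of_real ?N + 1) = ?N + 1"
      using N by (metis abs_of_nonneg add_nonneg_nonneg norm_of_real of_real_1 of_real_add zero_le_one)
    then have "(cmod ?c)\<^sup>2 * ?N = (cmod (ip y m))\<^sup>2 / (?N + 1) * (?N / (?N + 1))"
      by (simp add: norm_divide power_divide power2_eq_square)
    also have "\<dots> \<le> (cmod (ip y m))\<^sup>2 / (?N + 1) * 1"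
      using N by (intro mult_left_mono) auto
    finally show ?thesis by simp
  qed
  ultimately show ?thesis
    using assms by (simp add: nsq_diff scale_mem nsq_scale)
qed

lemma cmod_ip_square_le:
  assumes "y \<in> H" "m \<in> H"
  shows "(cmod (ip y m))\<^sup>2 \<le> (nsq m + 1) * nsq y"
proof -
  have "0 \<le> nsq y - (cmod (ip y m))\<^sup>2 / (nsq m + 1)"
    using nsq_reduce[OF assms] nsq_nonneg diff_mem scale_mem assms by (meson order_trans)
  then show ?thesis using nsq_nonneg[OF assms(2)] by (simp add: field_simps)
qed

lemma ip_tendsto_zero:
  assumes "\<And>n. X n \<in> H" "m \<in> H" "(\<lambda>n. nsq (X n)) \<longlonglongrightarrow> 0"
  shows "(\<lambda>n. ip (X n) m) \<longlonglongrightarrow> 0"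
proof -
  have "(\<lambda>n. (nsq m + 1) * nsq (X n)) \<longlonglongrightarrow> 0"
    using assms by (auto intro!: tendsto_eq_intros)
  then have "(\<lambda>n. (cmod (ip (X n) m))\<^sup>2) \<longlonglongrightarrow> 0"
    by (rule tendsto_sandwich[OF _ _ tendsto_const, rotated 2])
      (use assms cmod_ip_square_le in auto)
  then show ?thesis by (rule tendsto_zero_of_cmod_square)
qed

text \<open>A minimizing sequence in \<open>M\<close> for the distance to \<open>x\<close> is Cauchy by the parallelogram law, and its
  limit \<open>p\<close>, a point of the closure of \<open>M\<close>, is the projection.\<close>

theorem projection:
  assumes M: "cfun.subspace M" "M \<subseteq> H" and x: "x \<in> H"
  obtains p X where "p \<in> H" "\<And>n. X n \<in> M" "(\<lambda>n. nsq (X n - p)) \<longlonglongrightarrow> 0"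
    "\<And>m. m \<in> M \<Longrightarrow> ip (x - p) m = 0"
proof -
  have M_closed: "a + b \<in> M" "fun_scale c a \<in> M" "0 \<in> M" if "a \<in> M" "b \<in> M" for a b c
    using M that by (auto simp: cfun.subspace_def)
  define d where "d = Inf ((\<lambda>m. nsq (x - m)) ` M)"
  have bdd: "bdd_below ((\<lambda>m. nsq (x - m)) ` M)"
    using M x by (intro bdd_belowI[of _ 0]) (auto intro!: nsq_nonneg diff_mem)
  have d_le: "d \<le> nsq (x - m)" if "m \<in> M" for m
    unfolding d_def using that by (intro cInf_lower bdd) auto
  have ne: "(\<lambda>m. nsq (x - m)) ` M \<noteq> {}" using M by (auto simp: cfun.subspace_def)
  have "\<exists>m\<in>M. nsq (x - m) < d + 1 / real (Suc n)" for n
    using cInf_lessD[OF ne, of "d + 1 / real (Suc n)"] by (auto simp: d_def)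
  then obtain X where X: "\<And>n. X n \<in> M" "\<And>n. nsq (x - X n) < d + 1 / real (Suc n)"
    by metis
  have XH: "X n \<in> H" for n using X M by blast
  have gap: "nsq (X m - X n) \<le> 2 / real (Suc m) + 2 / real (Suc n)" for m n
  proof -
    let ?y = "x - X m" and ?z = "x - X n" and ?h = "fun_scale (1/2) (X m + X n)"
    have yz: "?y \<in> H" "?z \<in> H" using XH x diff_mem by auto
    have "?h \<in> M" using X M_closed by blast
    then have "4 * d \<le> 4 * nsq (x - ?h)" by (simp add: d_le)
    also have "\<dots> = nsq (fun_scale 2 (x - ?h))"
      using XH x by (subst nsq_scale) (auto intro: diff_mem scale_mem add_mem)
    also have "fun_scale 2 (x - ?h) = ?y + ?z"
      by (simp add: fun_eq_iff fun_scale_def plus_fun_apply minus_apply algebra_simps)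
    finally have "4 * d \<le> nsq (?y + ?z)" .
    moreover have "X m - X n = ?z - ?y" by simp
    ultimately show ?thesis
      using nsq_add[OF yz] nsq_diff[OF yz(2,1)] X(2)[of m] X(2)[of n] ip_commute[OF yz] by simp
  qed
  have "\<exists>p\<in>H. (\<lambda>n. Re (ip (X n - p) (X n - p))) \<longlonglongrightarrow> 0"
  proof (rule complete[OF XH])
    fix e :: real assume "0 < e"
    then obtain N where N: "4 / e < real N" using reals_Archimedean2 by blast
    have "nsq (X m - X n) < e" if "m \<ge> N" "n \<ge> N" for m n
    proof -
      have *: "2 / real (Suc k) < e / 2" if "k \<ge> N" for k
      proof -
        have "4 / e < real (Suc k)" using N that by simp
        then show ?thesis using \<open>0 < e\<close> by (simp add: field_simps)
      qed
      show ?thesis using gap[of m n] *[OF that(1)] *[OF that(2)] by linarith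
    qed
    then show "\<exists>N. \<forall>m\<ge>N. \<forall>n\<ge>N. Re (ip (X m - X n) (X m - X n)) < e"
      unfolding nsq_def by blast
  qed
  then obtain p where p: "p \<in> H" "(\<lambda>n. nsq (X n - p)) \<longlonglongrightarrow> 0" by (auto simp: nsq_def)
  have "ip (x - p) m = 0" if m: "m \<in> M" for m
  proof -
    have mH: "m \<in> H" using m M by blast
    have close: "(cmod (ip (x - X n) m))\<^sup>2 \<le> (nsq m + 1) * (1 / real (Suc n))" for n
    proof -
      let ?c = "ip (x - X n) m / (nsq m + 1)"
      have "X n + fun_scale ?c m \<in> M" using X m M_closed by blast
      then have "d \<le> nsq (x - (X n + fun_scale ?c m))" by (rule d_le)
      also have "x - (X n + fun_scale ?c m) = x - X n - fun_scale ?c m" by simp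
      also have "nsq \<dots> \<le> nsq (x - X n) - (cmod (ip (x - X n) m))\<^sup>2 / (nsq m + 1)"
        using XH x mH by (intro nsq_reduce diff_mem)
      finally have "(cmod (ip (x - X n) m))\<^sup>2 / (nsq m + 1) \<le> 1 / real (Suc n)"
        using X(2)[of n] by simp
      then show ?thesis using nsq_nonneg[OF mH] by (simp add: field_simps)
    qed
    have lim: "(\<lambda>n. (nsq m + 1) * (1 / real (Suc n))) \<longlonglongrightarrow> 0"
      by (intro tendsto_mult_right_zero LIMSEQ_Suc[OF lim_1_over_n])
    have "(\<lambda>n. (cmod (ip (x - X n) m))\<^sup>2) \<longlonglongrightarrow> 0"
      by (rule Lim_null_comparison[OF _ lim]) (use close in simp)
    then have "(\<lambda>n. ip (x - X n) m) \<longlonglongrightarrow> 0" by (rule tendsto_zero_of_cmod_square)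
    moreover have "(\<lambda>n. ip (X n - p) m) \<longlonglongrightarrow> 0"
      using XH p mH by (intro ip_tendsto_zero) (auto intro: diff_mem)
    ultimately have "(\<lambda>n. ip (x - X n) m + ip (X n - p) m) \<longlonglongrightarrow> 0 + 0"
      by (rule tendsto_add)
    moreover have "ip (x - X n) m + ip (X n - p) m = ip (x - p) m" for n
      using XH x p mH by (simp add: ip_diff_left)
    ultimately show ?thesis by (simp add: LIMSEQ_const_iff)
  qed
  with that[of p X] p X(1) show thesis by blast
qed

text \<open>By induction on the family: subtracting from \<open>e\<close> its component along one member
  leaves the coefficients at the other members unchanged.\<close>

theorem bessel:
  assumes "finite I" "\<And>i. i \<in> I \<Longrightarrow> y i \<in> H" "\<And>i. i \<in> I \<Longrightarrow> 0 < nsq (y i)"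
    and "\<And>i j. \<lbrakk>i \<in> I; j \<in> I; i \<noteq> j\<rbrakk> \<Longrightarrow> ip (y i) (y j) = 0" and "e \<in> H"
  shows "(\<Sum>i\<in>I. (cmod (ip e (y i)))\<^sup>2 / nsq (y i)) \<le> nsq e"
  using assms
proof (induction I arbitrary: e rule: finite_induct)
  case empty
  then show ?case by (simp add: nsq_nonneg)
next
  case (insert k I)
  have k: "y k \<in> H" "0 < nsq (y k)" using insert.prems by auto
  let ?c = "ip e (y k) / nsq (y k)"
  let ?e = "e - fun_scale ?c (y k)"
  have e: "?e \<in> H" using insert.prems k by (intro diff_mem scale_mem)
  have "ip e (fun_scale ?c (y k)) = cnj ?c * ip e (y k)"
    using insert.prems k by (intro ip_scale_right) auto
  also have "\<dots> = of_real ((cmod (ip e (y k)))\<^sup>2 / nsq (y k))"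
    by (simp add: complex_norm_square mult.commute del: of_real_power)
  finally have "Re (ip e (fun_scale ?c (y k))) = (cmod (ip e (y k)))\<^sup>2 / nsq (y k)"
    by (simp only: Re_complex_of_real)
  moreover have "(cmod ?c)\<^sup>2 * nsq (y k) = (cmod (ip e (y k)))\<^sup>2 / nsq (y k)"
    using k by (simp add: norm_divide power_divide power2_eq_square)
  ultimately have "nsq ?e = nsq e - (cmod (ip e (y k)))\<^sup>2 / nsq (y k)"
    using insert.prems k by (simp add: nsq_diff scale_mem nsq_scale)
  moreover have "(\<Sum>i\<in>I. (cmod (ip ?e (y i)))\<^sup>2 / nsq (y i)) \<le> nsq ?e"
    using insert.prems e by (intro insert.IH) auto
  moreover have "ip ?e (y i) = ip e (y i)" if "i \<in> I" for i
  proof -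
    have "ip (y k) (y i) = 0" using insert.prems(3)[of k i] insert.hyps that by auto
    then show ?thesis
      using insert.prems that k by (simp add: ip_diff_left scale_mem ip_scale_left)
  qed
  ultimately show ?case using insert.hyps by simp
qed

text \<open>For an isometry the adjoint of \<open>V\<close> at \<open>y\<close> is the preimage under \<open>V\<close> of the projection of \<open>y\<close> on the
  range of \<open>V\<close>; the preimages of a sequence tending to this projection converge.\<close>

theorem isometry_adjoint_exists:
  assumes V: "\<And>x. x \<in> H \<Longrightarrow> V x \<in> H" "\<And>x y. V (x + y) = V x + V y"
      "\<And>c x. V (fun_scale c x) = fun_scale c (V x)"
    and iso: "\<And>x y. \<lbrakk>x \<in> H; y \<in> H\<rbrakk> \<Longrightarrow> ip (V x) (V y) = ip x y" and y: "y \<in> H"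
  shows "\<exists>!h. h \<in> H \<and> (\<forall>x\<in>H. ip (V x) y = ip x h)"
proof (rule ex_ex1I)
  have V_diff: "V (a - b) = V a - V b" for a b
    unfolding diff_eq_add_scale V ..
  have V0: "V 0 = 0" using V_diff[of 0 0] by simp
  have "cfun.subspace (V ` H)"
  proof (rule cfun.subspaceI)
    show "0 \<in> V ` H" using zero_mem V0 by (metis imageI)
    show "a + b \<in> V ` H" if "a \<in> V ` H" "b \<in> V ` H" for a b
      using that add_mem V(2) by (smt (verit) image_iff)
    show "fun_scale c a \<in> V ` H" if "a \<in> V ` H" for c a
      using that scale_mem V(3) by (smt (verit) image_iff)
  qed
  moreover have "V ` H \<subseteq> H" using V(1) by blast
  ultimately obtain p X where p: "p \<in> H" "\<And>n. X n \<in> V ` H" "(\<lambda>n. nsq (X n - p)) \<longlonglongrightarrow> 0"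
    "\<And>m. m \<in> V ` H \<Longrightarrow> ip (y - p) m = 0"
    using projection[OF _ _ y] by blast
  obtain s where s: "\<And>n. s n \<in> H" "\<And>n. X n = V (s n)" using p(2) unfolding image_iff by metis
  have XH: "X n \<in> H" for n using s V by simp
  have gap: "nsq (s m - s n) \<le> 2 * nsq (X m - p) + 2 * nsq (X n - p)" for m n
  proof -
    let ?a = "X m - p" and ?b = "X n - p"
    have ab: "?a \<in> H" "?b \<in> H" using XH p diff_mem by auto
    have "nsq (s m - s n) = nsq (V (s m - s n))"
      using s by (simp add: nsq_def iso diff_mem)
    also have "V (s m - s n) = ?a - ?b" by (simp add: V_diff s)
    also have "nsq (?a - ?b) \<le> 2 * nsq ?a + 2 * nsq ?b"
      using nsq_add[OF ab] nsq_diff[OF ab] nsq_nonneg[OF add_mem[OF ab]] by simp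
    finally show ?thesis .
  qed
  have "\<exists>h\<in>H. (\<lambda>n. Re (ip (s n - h) (s n - h))) \<longlonglongrightarrow> 0"
  proof (rule complete[OF s(1)])
    fix e :: real assume "0 < e"
    then have "\<forall>\<^sub>F n in sequentially. nsq (X n - p) < e / 4"
      by (intro order_tendstoD(2)[OF p(3)]) simp
    then obtain N where N: "\<And>n. n \<ge> N \<Longrightarrow> nsq (X n - p) < e / 4"
      by (auto simp: eventually_sequentially)
    have "nsq (s m - s n) < e" if "m \<ge> N" "n \<ge> N" for m n
      using gap[of m n] N[OF that(1)] N[OF that(2)] by linarith
    then show "\<exists>N. \<forall>m\<ge>N. \<forall>n\<ge>N. Re (ip (s m - s n) (s m - s n)) < e"
      unfolding nsq_def by blast
  qed
  then obtain h where h: "h \<in> H" "(\<lambda>n. nsq (s n - h)) \<longlonglongrightarrow> 0" by (auto simp: nsq_def)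
  have "ip (V x) y = ip x h" if x: "x \<in> H" for x
  proof -
    have "ip (y - p) (V x) = 0" using p(4) x by blast
    then have "ip y (V x) = ip p (V x)" using y p(1) V(1)[OF x] by (simp add: ip_diff_left)
    moreover have "(\<lambda>n. ip (s n - h) x - ip (X n - p) (V x)) \<longlonglongrightarrow> 0 - 0"
      using s XH p h x V by (intro tendsto_diff ip_tendsto_zero) (auto intro: diff_mem)
    moreover have "ip (s n - h) x - ip (X n - p) (V x) = ip p (V x) - ip h x" for n
      using s XH[of n] p h x V(1) by (simp add: ip_diff_left iso)
    ultimately have "ip y (V x) = ip h x" by (simp add: LIMSEQ_const_iff)
    then show ?thesis using ip_commute y h x V(1) by metis
  qed
  with h show "\<exists>h. h \<in> H \<and> (\<forall>x\<in>H. ip (V x) y = ip x h)" by blast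
  show "h = h'" if "h \<in> H \<and> (\<forall>x\<in>H. ip (V x) y = ip x h)" "h' \<in> H \<and> (\<forall>x\<in>H. ip (V x) y = ip x h')" for h h'
    using that by (intro eq_by_ip) auto
qed

lemma closed_subspace:
  assumes S: "cfun.subspace S" "S \<subseteq> H"
    and closed: "\<And>x X. \<lbrakk>x \<in> H; \<And>n. X n \<in> S; (\<lambda>n. nsq (X n - x)) \<longlonglongrightarrow> 0\<rbrakk> \<Longrightarrow> x \<in> S"
  shows "function_hilbert S ip"
proof
  show "\<exists>x\<in>S. (\<lambda>n. Re (ip (X n - x) (X n - x))) \<longlonglongrightarrow> 0"
    if X: "\<And>n. X n \<in> S"
      and cauchy: "\<And>e. 0 < e \<Longrightarrow> \<exists>N. \<forall>m\<ge>N. \<forall>n\<ge>N. Re (ip (X m - X n) (X m - X n)) < e" for X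
  proof -
    obtain x where x: "x \<in> H" "(\<lambda>n. Re (ip (X n - x) (X n - x))) \<longlonglongrightarrow> 0"
      using complete[OF _ cauchy] X S(2) by (meson subsetD)
    then have "x \<in> S" using closed[of x X] X by (simp add: nsq_def)
    with x show ?thesis by blast
  qed
qed (use S in \<open>blast intro: ip_add_left ip_scale_left ip_commute ip_self_nonneg ip_definite\<close>)+

text \<open>The defect \<open>y - V (Vs y)\<close> is always killed by the adjoint. If no nonzero vector of \<open>R\<close> were,
  every vector of \<open>R\<close> would be in the range of all powers of \<open>V\<close>, which purity forbids.\<close>

lemma isometry_adjoint_kernel_nonzero:
  assumes V: "\<And>x. x \<in> H \<Longrightarrow> V x \<in> H" and Vs: "\<And>x. x \<in> H \<Longrightarrow> Vs x \<in> H"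
    and adj: "\<And>x y. \<lbrakk>x \<in> H; y \<in> H\<rbrakk> \<Longrightarrow> ip (V x) y = ip x (Vs y)"
    and iso: "\<And>x y. \<lbrakk>x \<in> H; y \<in> H\<rbrakk> \<Longrightarrow> ip (V x) (V y) = ip x y"
    and pure: "\<And>x. (\<And>n. x \<in> (V ^^ n) ` H) \<Longrightarrow> x = 0"
    and R: "R \<subseteq> H" "\<And>x y. \<lbrakk>x \<in> R; y \<in> R\<rbrakk> \<Longrightarrow> x - y \<in> R" "\<And>x. x \<in> R \<Longrightarrow> V x \<in> R"
      "\<And>x. x \<in> R \<Longrightarrow> Vs x \<in> R"
    and x: "x \<in> R" "x \<noteq> 0"
  shows "\<exists>k\<in>R. k \<noteq> 0 \<and> Vs k = 0"
proof (rule ccontr)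
  assume no: "\<not> ?thesis"
  have "y = V (Vs y)" if y: "y \<in> R" for y
  proof -
    let ?k = "y - V (Vs y)"
    have k: "?k \<in> R" using R y by blast
    have yH: "y \<in> H" "Vs y \<in> H" "V (Vs y) \<in> H" "?k \<in> H" using R y k by auto
    have "Vs ?k = 0"
    proof (rule eq_by_ip)
      fix z assume z: "z \<in> H"
      have "ip z (Vs ?k) = ip (V z) y - ip (V z) (V (Vs y))"
        using z yH V by (simp add: adj[symmetric] ip_diff_right)
      also have "\<dots> = 0" using adj[OF z yH(1)] iso[OF z yH(2)] by simp
      also have "\<dots> = ip z 0" using ip_commute[OF zero_mem z] ip_zero_left[OF z] by simp
      finally show "ip z (Vs ?k) = ip z 0" .
    qed (use Vs yH zero_mem in auto)
    with no k show ?thesis by auto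
  qed
  then have step: "y \<in> V ` R" if "y \<in> R" for y using that R(4) by blast
  have "R \<subseteq> (V ^^ n) ` R" for n
  proof (induction n)
    case (Suc n)
    have "R \<subseteq> V ` R" using step by blast
    also have "\<dots> \<subseteq> V ` (V ^^ n) ` R" using Suc by (rule image_mono)
    finally show ?case by (simp add: image_comp)
  qed simp
  then have "x \<in> (V ^^ n) ` H" for n using x R(1) by blast
  then show False using pure x(2) by blast
qed

end

section \<open>Doubly commuting pure isometries\<close>

text \<open>The relation \<open>VsW\<close> is double commutativity. Together with \<open>VW\<close> it makes each of \<open>V\<close>, \<open>Vs\<close> commute
  with each of \<open>W\<close>, \<open>Ws\<close>.\<close>

locale doubly_commuting_shifts = function_hilbert +
  fixes V W Vs Ws :: "('a \<Rightarrow> complex) \<Rightarrow> ('a \<Rightarrow> complex)"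
  assumes V_mem: "x \<in> H \<Longrightarrow> V x \<in> H" and W_mem: "x \<in> H \<Longrightarrow> W x \<in> H"
    and Vs_mem: "x \<in> H \<Longrightarrow> Vs x \<in> H" and Ws_mem: "x \<in> H \<Longrightarrow> Ws x \<in> H"
    and V_adj: "\<lbrakk>x \<in> H; y \<in> H\<rbrakk> \<Longrightarrow> ip (V x) y = ip x (Vs y)"
    and W_adj: "\<lbrakk>x \<in> H; y \<in> H\<rbrakk> \<Longrightarrow> ip (W x) y = ip x (Ws y)"
    and V_iso: "\<lbrakk>x \<in> H; y \<in> H\<rbrakk> \<Longrightarrow> ip (V x) (V y) = ip x y"
    and W_iso: "\<lbrakk>x \<in> H; y \<in> H\<rbrakk> \<Longrightarrow> ip (W x) (W y) = ip x y"
    and V_pure: "(\<And>n. x \<in> (V ^^ n) ` H) \<Longrightarrow> x = 0"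
    and W_pure: "(\<And>n. x \<in> (W ^^ n) ` H) \<Longrightarrow> x = 0"
    and VW: "x \<in> H \<Longrightarrow> V (W x) = W (V x)"
    and VsW: "x \<in> H \<Longrightarrow> Vs (W x) = W (Vs x)"
begin

definition wandering :: "('a \<Rightarrow> complex) \<Rightarrow> bool" where
  "wandering f \<longleftrightarrow> f \<in> H \<and> Vs f = 0 \<and> Ws f = 0"

abbreviation orbit :: "nat \<Rightarrow> nat \<Rightarrow> ('a \<Rightarrow> complex) \<Rightarrow> 'a \<Rightarrow> complex" where
  "orbit i j f \<equiv> (V ^^ i) ((W ^^ j) f)"

lemma ip_zero_right: "x \<in> H \<Longrightarrow> ip x 0 = 0"
  using ip_commute[OF zero_mem] ip_zero_left by simp

lemma Vpow_mem: "x \<in> H \<Longrightarrow> (V ^^ i) x \<in> H"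
  by (induction i) (auto simp: V_mem)

lemma Wpow_mem: "x \<in> H \<Longrightarrow> (W ^^ i) x \<in> H"
  by (induction i) (auto simp: W_mem)

lemma orbit_mem: "x \<in> H \<Longrightarrow> orbit i j x \<in> H"
  by (simp add: Vpow_mem Wpow_mem)

lemma Ws_W: "x \<in> H \<Longrightarrow> Ws (W x) = x"
  by (rule eq_by_ip) (simp_all add: Ws_mem W_mem W_adj[symmetric] W_iso)

lemma Vs_Ws: "x \<in> H \<Longrightarrow> Vs (Ws x) = Ws (Vs x)"
  by (rule eq_by_ip)
    (simp_all add: Ws_mem W_mem Vs_mem V_mem W_adj[symmetric] V_adj[symmetric] VW)

text \<open>The adjoint of the relation \<open>VsW\<close>.\<close>

lemma Ws_V: "x \<in> H \<Longrightarrow> Ws (V x) = V (Ws x)"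
proof (rule eq_by_ip)
  fix z assume "x \<in> H" "z \<in> H"
  then have "ip z (V (Ws x)) = cnj (ip (V (Ws x)) z)"
    by (intro ip_commute V_mem Ws_mem)
  also have "\<dots> = ip (Vs z) (Ws x)"
    using \<open>x \<in> H\<close> \<open>z \<in> H\<close> by (simp add: V_adj Ws_mem Vs_mem flip: ip_commute)
  also have "\<dots> = ip (Vs (W z)) x"
    using \<open>x \<in> H\<close> \<open>z \<in> H\<close> by (simp add: W_adj[symmetric] Vs_mem VsW)
  also have "\<dots> = cnj (ip (V x) (W z))"
    using \<open>x \<in> H\<close> \<open>z \<in> H\<close> by (simp add: V_adj Vs_mem W_mem flip: ip_commute)
  also have "\<dots> = ip z (Ws (V x))"
    using \<open>x \<in> H\<close> \<open>z \<in> H\<close> by (simp add: W_adj[symmetric] V_mem W_mem flip: ip_commute)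
  finally show "ip z (Ws (V x)) = ip z (V (Ws x))" ..
qed (simp_all add: V_mem Ws_mem)

lemma Vs_Wpow: "x \<in> H \<Longrightarrow> Vs ((W ^^ j) x) = (W ^^ j) (Vs x)"
  by (induction j) (auto simp: VsW Wpow_mem)

lemma Ws_Vpow: "x \<in> H \<Longrightarrow> Ws ((V ^^ j) x) = (V ^^ j) (Ws x)"
  by (induction j) (auto simp: Ws_V Vpow_mem)

lemma W_Vpow: "x \<in> H \<Longrightarrow> W ((V ^^ j) x) = (V ^^ j) (W x)"
  by (induction j) (auto simp: VW[symmetric] Vpow_mem)

lemma V_zero: "V 0 = 0"
  using V_iso[OF zero_mem zero_mem] ip_zero_left[OF zero_mem] ip_definite[OF V_mem[OF zero_mem]] by simp

lemma W_zero: "W 0 = 0"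
  using W_iso[OF zero_mem zero_mem] ip_zero_left[OF zero_mem] ip_definite[OF W_mem[OF zero_mem]] by simp

lemma Vpow_zero: "(V ^^ i) 0 = 0" by (induction i) (auto simp: V_zero)

lemma Wpow_zero: "(W ^^ i) 0 = 0" by (induction i) (auto simp: W_zero)

lemma Vs_diff: "x \<in> H \<Longrightarrow> y \<in> H \<Longrightarrow> Vs (x - y) = Vs x - Vs y"
  by (rule eq_by_ip) (simp_all add: Vs_mem diff_mem V_mem ip_diff_right flip: V_adj)

text \<open>The kernel of \<open>Vs\<close> in \<open>R\<close> is nonzero, and it is invariant under \<open>W\<close> and \<open>Ws\<close> by double
  commutativity, so the same argument applies to \<open>W\<close> on this kernel.\<close>

theorem wandering_exists:
  assumes R: "R \<subseteq> H" "\<And>x y. \<lbrakk>x \<in> R; y \<in> R\<rbrakk> \<Longrightarrow> x - y \<in> R"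
      "\<And>x. x \<in> R \<Longrightarrow> V x \<in> R" "\<And>x. x \<in> R \<Longrightarrow> W x \<in> R"
      "\<And>x. x \<in> R \<Longrightarrow> Vs x \<in> R" "\<And>x. x \<in> R \<Longrightarrow> Ws x \<in> R"
    and x: "x \<in> R" "x \<noteq> 0"
  shows "\<exists>f\<in>R. f \<noteq> 0 \<and> wandering f"
proof -
  let ?K = "{k \<in> R. Vs k = 0}"
  obtain k where k: "k \<in> ?K" "k \<noteq> 0"
    using isometry_adjoint_kernel_nonzero[OF V_mem Vs_mem V_adj V_iso V_pure R(1-3) R(5) x] by auto
  have "\<exists>f\<in>?K. f \<noteq> 0 \<and> Ws f = 0"
  proof (rule isometry_adjoint_kernel_nonzero[OF W_mem Ws_mem W_adj W_iso W_pure _ _ _ _ k])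
    show "?K \<subseteq> H" using R by auto
    show "y - z \<in> ?K" if "y \<in> ?K" "z \<in> ?K" for y z
      using that R Vs_diff[of y z] by auto
    show "W y \<in> ?K" if "y \<in> ?K" for y
      using that R VsW[of y] W_zero by auto
    show "Ws y \<in> ?K" if "y \<in> ?K" for y
    proof -
      have "Ws 0 = 0" using Ws_W[OF zero_mem] by (simp add: W_zero)
      then show ?thesis using that R Vs_Ws[of y] by auto
    qed
  qed
  then show ?thesis using R(1) by (auto simp: wandering_def)
qed

lemma ip_Vpow_iso: "f \<in> H \<Longrightarrow> g \<in> H \<Longrightarrow> ip ((V ^^ k) f) ((V ^^ k) g) = ip f g"
  by (induction k) (auto simp: V_iso Vpow_mem)

lemma ip_Wpow_iso: "f \<in> H \<Longrightarrow> g \<in> H \<Longrightarrow> ip ((W ^^ k) f) ((W ^^ k) g) = ip f g"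
  by (induction k) (auto simp: W_iso Wpow_mem)

text \<open>After cancelling \<open>k\<close> factors \<open>V\<close>, one more factor moves to the other side as its adjoint, where it
  commutes with the powers of \<open>W\<close> and kills \<open>g\<close>.\<close>

lemma ip_orbit_less_V:
  assumes f: "f \<in> H" and g: "wandering g" and "k < i"
  shows "ip (orbit i j f) (orbit k l g) = 0"
proof -
  have gH: "g \<in> H" "Vs g = 0" using g by (auto simp: wandering_def)
  obtain n where i: "i = k + Suc n" using \<open>k < i\<close> less_iff_Suc_add by auto
  have "ip (orbit i j f) (orbit k l g) = ip (V ((V ^^ n) ((W ^^ j) f))) ((W ^^ l) g)"
    unfolding i funpow_add o_apply using f gH
    by (subst ip_Vpow_iso) (auto intro!: V_mem Vpow_mem Wpow_mem)
  also have "\<dots> = 0"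
    using f gH by (simp add: V_adj Vpow_mem Wpow_mem Vs_Wpow Wpow_zero ip_zero_right)
  finally show ?thesis .
qed

lemma ip_orbit_less_W:
  assumes f: "f \<in> H" and g: "wandering g" and "l < j"
  shows "ip (orbit i j f) (orbit i l g) = 0"
proof -
  have gH: "g \<in> H" "Ws g = 0" using g by (auto simp: wandering_def)
  obtain n where j: "j = l + Suc n" using \<open>l < j\<close> less_iff_Suc_add by auto
  have "ip (orbit i j f) (orbit i l g) = ip (W ((W ^^ n) f)) g"
    unfolding j funpow_add o_apply using f gH
    by (simp add: ip_Vpow_iso ip_Wpow_iso W_mem Wpow_mem)
  also have "\<dots> = 0"
    using f gH by (simp add: W_adj Wpow_mem ip_zero_right)
  finally show ?thesis .
qed

theorem orbits_orthogonal:
  assumes f: "wandering f" and g: "wandering g" and ne: "(i, j) \<noteq> (k, l) \<or> ip f g = 0"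
  shows "ip (orbit i j f) (orbit k l g) = 0"
proof -
  have H: "f \<in> H" "g \<in> H" using f g by (auto simp: wandering_def)
  have flip: "ip (orbit i j f) (orbit k l g) = cnj (ip (orbit k l g) (orbit i j f))"
    using H by (intro ip_commute orbit_mem)
  consider "k < i" | "i < k" | "i = k" "l < j" | "i = k" "j < l" | "i = k" "j = l"
    by linarith
  then show ?thesis
  proof cases
    case 5
    then have "ip f g = 0" using ne by simp
    then show ?thesis using 5 H by (simp add: ip_Vpow_iso ip_Wpow_iso Wpow_mem)
  qed (use flip ip_orbit_less_V[OF H(1) g] ip_orbit_less_V[OF H(2) f]
      ip_orbit_less_W[OF H(1) g] ip_orbit_less_W[OF H(2) f] in auto)
qed

text \<open>The vectors orthogonal to the orbit of \<open>f\<close> form a reducing subspace. A nonzero one would yield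
  a nonzero wandering vector orthogonal to \<open>f\<close>.\<close>

theorem orbit_span_dense:
  assumes f: "wandering f"
    and unique: "\<And>g. wandering g \<Longrightarrow> ip g f = 0 \<Longrightarrow> g = 0" and x: "x \<in> H"
  shows "\<exists>X. (\<forall>n. X n \<in> cfun.span {orbit i j f | i j. True}) \<and> (\<lambda>n. nsq (X n - x)) \<longlonglongrightarrow> 0"
proof -
  let ?M = "cfun.span {orbit i j f | i j. True}"
  have fH: "f \<in> H" "Vs f = 0" "Ws f = 0" using f by (auto simp: wandering_def)
  define R where "R = {y \<in> H. \<forall>i j. ip y (orbit i j f) = 0}"
  have "?M \<subseteq> H"
    using orbit_mem[OF fH(1)] by (intro cfun.span_minimal subspace) auto
  then obtain p X where p: "p \<in> H" "\<And>n. X n \<in> ?M" "(\<lambda>n. nsq (X n - p)) \<longlonglongrightarrow> 0"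
    "\<And>m. m \<in> ?M \<Longrightarrow> ip (x - p) m = 0"
    using projection[OF cfun.subspace_span _ x, of "{orbit i j f | i j. True}"] by blast
  have "orbit i j f \<in> ?M" for i j by (intro cfun.span_base) auto
  then have xp: "x - p \<in> R" using p x by (auto simp: R_def diff_mem)
  have "x - p = 0"
  proof (rule ccontr)
    assume "x - p \<noteq> 0"
    with xp have "\<exists>g\<in>R. g \<noteq> 0 \<and> wandering g"
    proof (rule wandering_exists[rotated 6])
      show "R \<subseteq> H" by (auto simp: R_def)
      show "y - z \<in> R" if "y \<in> R" "z \<in> R" for y z
        using that fH by (auto simp: R_def diff_mem ip_diff_left orbit_mem)
      fix y assume "y \<in> R"
      then have y: "y \<in> H" "\<And>i j. ip y (orbit i j f) = 0" by (auto simp: R_def)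
      have "ip (V y) (orbit i j f) = 0" for i j
      proof (cases i)
        case 0
        then show ?thesis using y fH by (simp add: V_adj Wpow_mem Vs_Wpow Wpow_zero ip_zero_right)
      next
        case (Suc n)
        then show ?thesis using y fH by (simp add: V_iso orbit_mem)
      qed
      then show "V y \<in> R" using y by (simp add: R_def V_mem)
      have "ip (W y) (orbit i j f) = 0" for i j
      proof (cases j)
        case 0
        then show ?thesis using y fH by (simp add: W_adj Vpow_mem Ws_Vpow Vpow_zero ip_zero_right)
      next
        case (Suc n)
        then show ?thesis using y fH by (simp add: W_iso orbit_mem Wpow_mem flip: W_Vpow)
      qed
      then show "W y \<in> R" using y by (simp add: R_def W_mem)
      have "ip (Vs y) (orbit i j f) = cnj (ip (orbit (Suc i) j f) y)" for i j
        using y fH by (simp add: V_adj orbit_mem Vs_mem flip: ip_commute)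
      then show "Vs y \<in> R" using y fH by (simp add: R_def Vs_mem ip_commute[OF y(1)] orbit_mem V_mem del: funpow.simps)
      have "ip (Ws y) (orbit i j f) = cnj (ip (orbit i (Suc j) f) y)" for i j
        using y fH by (simp add: W_adj orbit_mem Ws_mem Wpow_mem flip: ip_commute W_Vpow)
      then show "Ws y \<in> R" using y fH by (simp add: R_def Ws_mem ip_commute[OF y(1)] orbit_mem del: funpow.simps)
    qed
    then obtain g where "g \<in> R" "g \<noteq> 0" "wandering g" by blast
    moreover have "ip g (orbit 0 0 f) = 0" using \<open>g \<in> R\<close> unfolding R_def by blast
    ultimately show False using unique[of g] by simp
  qed
  then have "x = p" by simp
  with p show ?thesis by blast
qed

end

section \<open>The Hardy space as a sequence space\<close>

definition l2_inner :: "(nat \<times> nat \<Rightarrow> complex) \<Rightarrow> (nat \<times> nat \<Rightarrow> complex) \<Rightarrow> complex" where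
  "l2_inner a b = (\<Sum>\<^sub>\<infinity>p. a p * cnj (b p))"

lemma square_summable_scale:
  "square_summable a \<Longrightarrow> square_summable (fun_scale c a)"
  by (simp add: square_summable_def fun_scale_def norm_mult power_mult_distrib summable_on_cmult_right)

lemma square_summable_add:
  assumes "square_summable a" "square_summable b"
  shows "square_summable (a + b)"
  unfolding square_summable_def
proof (rule summable_on_comparison_test)
  show "(\<lambda>p. 2 * (cmod (a p))\<^sup>2 + 2 * (cmod (b p))\<^sup>2) summable_on UNIV"
    using assms by (intro summable_on_add summable_on_cmult_right) (auto simp: square_summable_def)
  show "(cmod ((a + b) p))\<^sup>2 \<le> 2 * (cmod (a p))\<^sup>2 + 2 * (cmod (b p))\<^sup>2" for p
  proof -
    have "(cmod (a p + b p))\<^sup>2 \<le> (cmod (a p) + cmod (b p))\<^sup>2"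
      by (intro power_mono norm_triangle_ineq) auto
    also have "\<dots> \<le> 2 * (cmod (a p))\<^sup>2 + 2 * (cmod (b p))\<^sup>2"
      using sum_squares_bound[of "cmod (a p)" "cmod (b p)"] by (simp add: power2_sum)
    finally show ?thesis by (simp add: plus_fun_apply)
  qed
qed auto

lemma square_summable_diff:
  assumes "square_summable a" "square_summable b"
  shows "square_summable (a - b)"
  unfolding diff_eq_add_scale using assms
  by (intro square_summable_add square_summable_scale)

lemma l2_inner_self:
  assumes "square_summable a"
  shows "l2_inner a a = of_real (\<Sum>\<^sub>\<infinity>p. (cmod (a p))\<^sup>2)"
proof -
  have "((\<lambda>p. (cmod (a p))\<^sup>2) has_sum (\<Sum>\<^sub>\<infinity>p. (cmod (a p))\<^sup>2)) UNIV"
    using assms by (simp add: square_summable_def)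
  then have "((\<lambda>p. complex_of_real ((cmod (a p))\<^sup>2)) has_sum of_real (\<Sum>\<^sub>\<infinity>p. (cmod (a p))\<^sup>2)) UNIV"
    by (simp only: has_sum_of_real_iff)
  then show ?thesis
    unfolding l2_inner_def complex_norm_square by (rule infsumI)
qed

lemma l2_inner_summable:
  assumes "square_summable a" "square_summable b"
  shows "(\<lambda>p. a p * cnj (b p)) summable_on UNIV"
proof (rule Infinite_Sum.abs_summable_summable, rule summable_on_comparison_test)
  show "(\<lambda>p. (cmod (a p))\<^sup>2 + (cmod (b p))\<^sup>2) summable_on UNIV"
    using assms by (intro summable_on_add) (auto simp: square_summable_def)
  show "norm (a p * cnj (b p)) \<le> (cmod (a p))\<^sup>2 + (cmod (b p))\<^sup>2" for p
    using sum_squares_bound[of "cmod (a p)" "cmod (b p)"]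
      mult_nonneg_nonneg[OF norm_ge_zero[of "a p"] norm_ge_zero[of "b p"]]
    unfolding norm_mult complex_mod_cnj by linarith
qed auto

lemma l2_inner_add_left:
  assumes "square_summable a" "square_summable b" "square_summable c"
  shows "l2_inner (a + b) c = l2_inner a c + l2_inner b c"
  unfolding l2_inner_def
  by (subst infsum_add[symmetric]) (simp_all add: assms l2_inner_summable plus_fun_apply distrib_right)

lemma l2_inner_scale_left: "l2_inner (fun_scale c a) b = c * l2_inner a b"
  unfolding l2_inner_def infsum_cmult_right'[symmetric] by (simp add: fun_scale_def mult.assoc)

lemma l2_inner_commute: "l2_inner b a = cnj (l2_inner a b)"
  unfolding l2_inner_def infsum_cnj[symmetric] by (simp add: mult.commute)

text \<open>The pointwise limit of a Cauchy sequence is its limit in norm: the Cauchy estimate holds for sums over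
  a finite set of indices, and there one of the two indices of the sequence may tend to infinity.\<close>

theorem l2_complete:
  fixes a :: "nat \<Rightarrow> nat \<times> nat \<Rightarrow> complex"
  assumes a: "\<And>n. square_summable (a n)"
    and cauchy: "\<And>e. 0 < e \<Longrightarrow> \<exists>N. \<forall>m\<ge>N. \<forall>n\<ge>N. (\<Sum>\<^sub>\<infinity>p. (cmod (a m p - a n p))\<^sup>2) < e"
  obtains b where "square_summable b" "(\<lambda>n. \<Sum>\<^sub>\<infinity>p. (cmod (a n p - b p))\<^sup>2) \<longlonglongrightarrow> 0"
proof -
  have diff: "(\<lambda>p. (cmod (a m p - a n p))\<^sup>2) summable_on UNIV" for m n
    using square_summable_diff[OF a a, of m n] by (simp add: square_summable_def minus_apply)
  have fin: "(\<Sum>p\<in>F. (cmod (a m p - a n p))\<^sup>2) \<le> (\<Sum>\<^sub>\<infinity>p. (cmod (a m p - a n p))\<^sup>2)" if "finite F" for F m n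
    using that by (intro finite_sum_le_infsum diff) auto
  have pointwise: "Cauchy (\<lambda>n. a n p)" for p
  proof (rule CauchyI)
    fix e :: real assume "0 < e"
    then obtain N where N: "\<And>m n. \<lbrakk>m \<ge> N; n \<ge> N\<rbrakk> \<Longrightarrow> (\<Sum>\<^sub>\<infinity>p. (cmod (a m p - a n p))\<^sup>2) < e\<^sup>2"
      using cauchy[of "e\<^sup>2"] by auto
    have "cmod (a m p - a n p) < e" if "m \<ge> N" "n \<ge> N" for m n
    proof -
      have "(cmod (a m p - a n p))\<^sup>2 < e\<^sup>2"
        using fin[of "{p}" m n] N[OF that] by simp
      then show ?thesis using \<open>0 < e\<close> by (rule power_less_imp_less_base[OF _ less_imp_le])
    qed
    then show "\<exists>M. \<forall>m\<ge>M. \<forall>n\<ge>M. cmod (a m p - a n p) < e" by blast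
  qed
  define b where "b = (\<lambda>p. lim (\<lambda>n. a n p))"
  have b: "(\<lambda>n. a n p) \<longlonglongrightarrow> b p" for p
    using pointwise[of p] unfolding b_def Cauchy_convergent_iff convergent_LIMSEQ_iff .
  have tail: "\<exists>N. \<forall>n\<ge>N. square_summable (a n - b) \<and> (\<Sum>\<^sub>\<infinity>p. (cmod (a n p - b p))\<^sup>2) \<le> e"
    if e: "0 < e" for e
  proof -
    obtain N where N: "\<And>m n. \<lbrakk>m \<ge> N; n \<ge> N\<rbrakk> \<Longrightarrow> (\<Sum>\<^sub>\<infinity>p. (cmod (a m p - a n p))\<^sup>2) < e"
      using cauchy[OF e] by auto
    have "square_summable (a n - b) \<and> (\<Sum>\<^sub>\<infinity>p. (cmod (a n p - b p))\<^sup>2) \<le> e" if n: "n \<ge> N" for n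
    proof -
      have F: "(\<Sum>p\<in>F. (cmod (a n p - b p))\<^sup>2) \<le> e" if "finite F" for F
      proof (rule tendsto_upperbound)
        show "(\<lambda>m. \<Sum>p\<in>F. (cmod (a n p - a m p))\<^sup>2) \<longlonglongrightarrow> (\<Sum>p\<in>F. (cmod (a n p - b p))\<^sup>2)"
          by (intro tendsto_intros b)
        have "(\<Sum>p\<in>F. (cmod (a n p - a m p))\<^sup>2) \<le> e" if "m \<ge> N" for m
          using fin[OF \<open>finite F\<close>, of n m] N[OF n that] by linarith
        then show "\<forall>\<^sub>F m in sequentially. (\<Sum>p\<in>F. (cmod (a n p - a m p))\<^sup>2) \<le> e"
          by (auto simp: eventually_sequentially)
      qed simp
      have "(\<lambda>p. (cmod (a n p - b p))\<^sup>2) summable_on UNIV"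
        by (rule nonneg_bdd_above_summable_on) (use F in \<open>auto intro!: bdd_aboveI[of _ e]\<close>)
      then show ?thesis
        using infsum_le_finite_sums[of "\<lambda>p. (cmod (a n p - b p))\<^sup>2" UNIV e] F
        by (simp add: square_summable_def minus_apply)
    qed
    then show ?thesis by blast
  qed
  show thesis
  proof (rule that)
    obtain n where "square_summable (a n - b)" using tail[of 1] by auto
    from square_summable_diff[OF a[of n] this] show "square_summable b" by simp
    show "(\<lambda>n. \<Sum>\<^sub>\<infinity>p. (cmod (a n p - b p))\<^sup>2) \<longlonglongrightarrow> 0"
    proof (rule LIMSEQ_I)
      fix e :: real assume "0 < e"
      then obtain N where "\<forall>n\<ge>N. (\<Sum>\<^sub>\<infinity>p. (cmod (a n p - b p))\<^sup>2) \<le> e / 2" using tail[of "e / 2"] by auto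
      moreover have "0 \<le> (\<Sum>\<^sub>\<infinity>p. (cmod (a n p - b p))\<^sup>2)" for n by (rule infsum_nonneg) auto
      ultimately show "\<exists>N. \<forall>n\<ge>N. norm ((\<Sum>\<^sub>\<infinity>p. (cmod (a n p - b p))\<^sup>2) - 0) < e"
        using \<open>0 < e\<close> by (intro exI[of _ N]) force
    qed
  qed
qed

lemma hartogs_series_add:
  assumes "square_summable a" "square_summable b"
  shows "hartogs_series (a + b) = hartogs_series a + hartogs_series b"
proof
  fix p :: "complex \<times> complex"
  obtain z w where p: "p = (z, w)" by fastforce
  show "hartogs_series (a + b) p = (hartogs_series a + hartogs_series b) p"
  proof (cases "p \<in> hartogs_triangle")
    case True
    then have uw: "cmod (z / w) < 1" "cmod w < 1"
      by (auto simp: p hartogs_triangle_def norm_divide divide_less_eq_1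
          intro: le_less_trans[OF norm_ge_zero])
    have s: "(\<lambda>(i, j). a (i, j) * (z / w) ^ i * w ^ j) summable_on UNIV"
      if "square_summable a" for a
      by (rule Infinite_Sum.abs_summable_summable)
        (use bidisc_series_abs_summable[OF that uw] in \<open>simp add: case_prod_unfold\<close>)
    have "bidisc_series (a + b) (z / w) w = bidisc_series a (z / w) w + bidisc_series b (z / w) w"
      unfolding bidisc_series_def infsum_add[OF s[OF assms(1)] s[OF assms(2)], symmetric]
      by (rule infsum_cong) (auto simp: plus_fun_apply algebra_simps)
    then show ?thesis using True by (simp add: p hartogs_series_def plus_fun_apply add_divide_distrib)
  qed (simp add: p hartogs_series_def plus_fun_apply)
qed

lemma hartogs_series_scale: "hartogs_series (fun_scale c a) = fun_scale c (hartogs_series a)"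
proof -
  have "bidisc_series (fun_scale c a) u w = c * bidisc_series a u w" for u w
    unfolding bidisc_series_def infsum_cmult_right'[symmetric]
    by (rule infsum_cong) (auto simp: fun_scale_def)
  then show ?thesis by (auto simp: hartogs_series_def fun_scale_def fun_eq_iff)
qed

lemma hartogs_series_diff:
  assumes "square_summable a" "square_summable b"
  shows "hartogs_series (a - b) = hartogs_series a - hartogs_series b"
  unfolding diff_eq_add_scale using assms
  by (simp only: hartogs_series_add hartogs_series_scale square_summable_scale)

lemma polarization:
  "(\<Sum>k<4. \<i> ^ k * of_real ((cmod (x + \<i> ^ k * y))\<^sup>2)) / 4 = x * cnj y"
proof -
  have "(\<Sum>k<4. \<i> ^ k * of_real ((cmod (x + \<i> ^ k * y))\<^sup>2)) =
      (\<Sum>k<4. \<i> ^ k * ((x + \<i> ^ k * y) * cnj (x + \<i> ^ k * y)))"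
    by (simp only: complex_norm_square)
  also have "\<dots> = 4 * (x * cnj y)"
    by (simp add: numeral_eq_Suc algebra_simps)
  finally show ?thesis by simp
qed

lemma has_sum_finite_sum:
  fixes f :: "'i \<Rightarrow> 'a \<Rightarrow> 'b :: real_normed_vector"
  assumes "finite K" "\<And>k. k \<in> K \<Longrightarrow> (f k has_sum s k) A"
  shows "((\<lambda>x. \<Sum>k\<in>K. f k x) has_sum (\<Sum>k\<in>K. s k)) A"
  using assms by (induction K rule: finite_induct) (auto intro: has_sum_add)

text \<open>The inner product is defined by polarization from the norm, so this is the polarization identity
  applied in every coefficient.\<close>

theorem hardy_inner_hartogs_series:
  assumes a: "square_summable a" and b: "square_summable b"
  shows "hardy_inner (hartogs_series a) (hartogs_series b) = l2_inner a b"
proof -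
  have "((\<lambda>p. complex_of_real ((cmod ((a + fun_scale (\<i> ^ k) b) p))\<^sup>2)) has_sum
      of_real ((hardy_norm (hartogs_series a + fun_scale (\<i> ^ k) (hartogs_series b)))\<^sup>2)) UNIV" for k
  proof -
    have s: "square_summable (a + fun_scale (\<i> ^ k) b)"
      by (intro square_summable_add square_summable_scale a b)
    have "hartogs_series a + fun_scale (\<i> ^ k) (hartogs_series b) = hartogs_series (a + fun_scale (\<i> ^ k) b)"
      using a b by (simp only: hartogs_series_add hartogs_series_scale square_summable_scale)
    then show ?thesis
      using s unfolding has_sum_of_real_iff
      by (simp add: hardy_norm_hartogs_series square_summable_def infsum_nonneg)
  qed
  then have "((\<lambda>p. (\<Sum>k<4. \<i> ^ k * of_real ((cmod ((a + fun_scale (\<i> ^ k) b) p))\<^sup>2)) / 4) has_sum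
      hardy_inner (hartogs_series a) (hartogs_series b)) UNIV"
    unfolding hardy_inner_def
    by (intro has_sum_divide_const has_sum_finite_sum has_sum_cmult_right) auto
  then show ?thesis
    by (simp add: plus_fun_apply fun_scale_def polarization l2_inner_def infsumI del: of_real_power)
qed


lemma hartogs_series_zero: "hartogs_series 0 = 0"
  using hartogs_series_scale[of 0 0] by (simp only: cfun.scale_zero_left)

lemma square_summable_eq_zero:
  assumes a: "square_summable a" and "(\<Sum>\<^sub>\<infinity>p. (cmod (a p))\<^sup>2) = 0"
  shows "a = 0"
proof
  fix p
  have "(cmod (a p))\<^sup>2 \<le> (\<Sum>\<^sub>\<infinity>p. (cmod (a p))\<^sup>2)"
    using finite_sum_le_infsum[of "\<lambda>p. (cmod (a p))\<^sup>2" UNIV "{p}"] a by (simp add: square_summable_def)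
  then show "a p = 0 p" using assms by (simp add: zero_fun_apply)
qed

lemma hardy_inner_self:
  assumes "square_summable a"
  shows "Re (hardy_inner (hartogs_series a) (hartogs_series a)) = (\<Sum>\<^sub>\<infinity>p. (cmod (a p))\<^sup>2)"
  by (simp add: hardy_inner_hartogs_series assms l2_inner_self)

interpretation hardy: function_hilbert hardy_space hardy_inner
proof
  show "cfun.subspace hardy_space"
  proof (rule cfun.subspaceI)
    have "square_summable 0" by (simp add: square_summable_def zero_fun_apply)
    from hartogs_series_in_hardy_space[OF this] show "0 \<in> hardy_space"
      by (simp only: hartogs_series_zero)
    show "f + g \<in> hardy_space" if fg: "f \<in> hardy_space" "g \<in> hardy_space" for f g
    proof -
      obtain a b where "square_summable a" "f = hartogs_series a" "square_summable b" "g = hartogs_series b"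
        using fg by (metis hardy_space_expansion)
      then show ?thesis
        using hartogs_series_in_hardy_space[OF square_summable_add[of a b]] by (simp only: hartogs_series_add)
    qed
    show "fun_scale c f \<in> hardy_space" if f: "f \<in> hardy_space" for c f
    proof -
      obtain a where "square_summable a" "f = hartogs_series a" using f by (metis hardy_space_expansion)
      then show ?thesis
        using hartogs_series_in_hardy_space[OF square_summable_scale[of a c]] by (simp only: hartogs_series_scale)
    qed
  qed
next
  fix f g h :: "complex \<times> complex \<Rightarrow> complex" and c :: complex
  assume f: "f \<in> hardy_space"
  then obtain a where a: "square_summable a" "f = hartogs_series a" by (metis hardy_space_expansion)
  show "0 \<le> Re (hardy_inner f f)" using a by (simp add: hardy_inner_self infsum_nonneg)
  show "f = 0" if "Re (hardy_inner f f) = 0"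
    using that a square_summable_eq_zero[OF a(1)] by (simp add: hardy_inner_self hartogs_series_zero)
  assume g: "g \<in> hardy_space"
  then obtain b where b: "square_summable b" "g = hartogs_series b" by (metis hardy_space_expansion)
  show "hardy_inner (fun_scale c f) g = c * hardy_inner f g"
    using a b by (simp add: hardy_inner_hartogs_series l2_inner_scale_left square_summable_scale
        flip: hartogs_series_scale)
  show "hardy_inner g f = cnj (hardy_inner f g)"
    using a b by (simp add: hardy_inner_hartogs_series l2_inner_commute[of b a])
  assume "h \<in> hardy_space"
  then obtain d where d: "square_summable d" "h = hartogs_series d" by (metis hardy_space_expansion)
  show "hardy_inner (f + g) h = hardy_inner f h + hardy_inner g h"
    using a b d by (simp add: hardy_inner_hartogs_series l2_inner_add_left square_summable_add
        flip: hartogs_series_add)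
next
  fix X :: "nat \<Rightarrow> complex \<times> complex \<Rightarrow> complex"
  assume X: "\<And>n. X n \<in> hardy_space"
    and cauchy: "\<And>e. 0 < e \<Longrightarrow> \<exists>N. \<forall>m\<ge>N. \<forall>n\<ge>N. Re (hardy_inner (X m - X n) (X m - X n)) < e"
  have "\<exists>a. square_summable a \<and> X n = hartogs_series a" for n
    using hardy_space_expansion[OF X] by metis
  then obtain a where a: "\<And>n. square_summable (a n)" "\<And>n. X n = hartogs_series (a n)" by metis
  have diff: "Re (hardy_inner (hartogs_series c - hartogs_series d) (hartogs_series c - hartogs_series d)) =
      (\<Sum>\<^sub>\<infinity>p. (cmod (c p - d p))\<^sup>2)" if "square_summable c" "square_summable d" for c d
    using hardy_inner_self[OF square_summable_diff[OF that]] that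
    by (simp add: hartogs_series_diff minus_apply)
  have "\<exists>N. \<forall>m\<ge>N. \<forall>n\<ge>N. (\<Sum>\<^sub>\<infinity>p. (cmod (a m p - a n p))\<^sup>2) < e" if "0 < e" for e
    using cauchy[OF that] unfolding a(2) diff[OF a(1) a(1)] .
  then obtain b where b: "square_summable b" "(\<lambda>n. \<Sum>\<^sub>\<infinity>p. (cmod (a n p - b p))\<^sup>2) \<longlonglongrightarrow> 0"
    by (rule l2_complete[OF a(1)])
  then show "\<exists>x\<in>hardy_space. (\<lambda>n. Re (hardy_inner (X n - x) (X n - x))) \<longlonglongrightarrow> 0"
    using hartogs_series_in_hardy_space[OF b(1)] unfolding a(2)
    by (intro bexI[of _ "hartogs_series b"]) (simp_all add: diff[OF a(1) b(1)])
qed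

lemma hardy_norm_eq:
  assumes "f \<in> hardy_space"
  shows "hardy_norm f = sqrt (hardy.nsq f)"
proof -
  obtain a where "square_summable a" "f = hartogs_series a" using assms by (metis hardy_space_expansion)
  then show ?thesis by (simp add: hardy.nsq_def hardy_inner_self hardy_norm_hartogs_series)
qed

text \<open>The coefficients of \<open>z\<^sup>k w\<^sup>l f\<close>. As \<open>z = u w\<close>, a factor \<open>z\<close> raises both exponents.\<close>

definition shift_coeffs :: "nat \<Rightarrow> nat \<Rightarrow> (nat \<times> nat \<Rightarrow> complex) \<Rightarrow> nat \<times> nat \<Rightarrow> complex" where
  "shift_coeffs k l a = (\<lambda>(i, j). if k \<le> i \<and> k + l \<le> j then a (i - k, j - (k + l)) else 0)"

text \<open>A sum over shifted coefficients is the sum over the original ones with shifted indices, for any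
  summand \<open>g\<close> that vanishes at coefficient \<open>0\<close>. Norms, inner products and power series are
  all of this form.\<close>

lemma shift_coeffs_sum:
  fixes g :: "complex \<Rightarrow> nat \<times> nat \<Rightarrow> 'b :: banach"
  assumes "\<And>p. g 0 p = 0"
  shows "(\<lambda>p. g (shift_coeffs k l a p) p) summable_on UNIV \<longleftrightarrow>
      (\<lambda>(i, j). g (a (i, j)) (i + k, j + (k + l))) summable_on UNIV"
    and "(\<Sum>\<^sub>\<infinity>p. g (shift_coeffs k l a p) p) = (\<Sum>\<^sub>\<infinity>(i, j). g (a (i, j)) (i + k, j + (k + l)))"
proof -
  let ?\<phi> = "\<lambda>(i, j). (i + k, j + (k + l))"
  have inj: "inj ?\<phi>" by (auto simp: inj_def)
  have out: "g (shift_coeffs k l a p) p = 0" if "p \<in> UNIV - range ?\<phi>" for p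
  proof -
    obtain i j where p: "p = (i, j)" by fastforce
    have "\<not> (k \<le> i \<and> k + l \<le> j)"
    proof
      assume "k \<le> i \<and> k + l \<le> j"
      then have "p = ?\<phi> (i - k, j - (k + l))" by (simp add: p)
      then show False using that by blast
    qed
    then have "shift_coeffs k l a p = 0" by (auto simp: p shift_coeffs_def)
    then show ?thesis by (simp add: assms)
  qed
  have comp: "(\<lambda>p. g (shift_coeffs k l a p) p) \<circ> ?\<phi> = (\<lambda>(i, j). g (a (i, j)) (i + k, j + (k + l)))"
    by (auto simp: fun_eq_iff shift_coeffs_def)
  show "(\<lambda>p. g (shift_coeffs k l a p) p) summable_on UNIV \<longleftrightarrow>
      (\<lambda>(i, j). g (a (i, j)) (i + k, j + (k + l))) summable_on UNIV"
    unfolding comp[symmetric] summable_on_reindex[OF inj, symmetric]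
    by (rule summable_on_cong_neutral) (use out in auto)
  show "(\<Sum>\<^sub>\<infinity>p. g (shift_coeffs k l a p) p) = (\<Sum>\<^sub>\<infinity>(i, j). g (a (i, j)) (i + k, j + (k + l)))"
    unfolding comp[symmetric] infsum_reindex[OF inj, symmetric]
    by (rule infsum_cong_neutral) (use out in auto)
qed

lemma square_summable_shift:
  assumes "square_summable a"
  shows "square_summable (shift_coeffs k l a)"
  using shift_coeffs_sum(1)[of "\<lambda>x p. (cmod x)\<^sup>2" k l a] assms
  by (simp add: square_summable_def case_prod_unfold)

lemma l2_inner_shift: "l2_inner (shift_coeffs k l a) (shift_coeffs k l b) = l2_inner a b"
  using shift_coeffs_sum(2)[of "\<lambda>x p. x * cnj (shift_coeffs k l b p)" k l a]
  by (simp add: l2_inner_def shift_coeffs_def case_prod_unfold)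

lemma hartogs_series_shift:
  "hartogs_series (shift_coeffs k l a) (z, w) = z ^ k * (w ^ l * hartogs_series a (z, w))"
proof (cases "(z, w) \<in> hartogs_triangle")
  case True
  then have w: "w \<noteq> 0" by (auto simp: hartogs_triangle_def)
  have "bidisc_series (shift_coeffs k l a) u w = u ^ k * w ^ (k + l) * bidisc_series a u w" for u
  proof -
    have "bidisc_series (shift_coeffs k l a) u w =
        (\<Sum>\<^sub>\<infinity>(i, j). a (i, j) * u ^ (i + k) * w ^ (j + (k + l)))"
      using shift_coeffs_sum(2)[of "\<lambda>x p. x * u ^ fst p * w ^ snd p" k l a]
      by (simp add: bidisc_series_def case_prod_unfold)
    also have "\<dots> = u ^ k * w ^ (k + l) * bidisc_series a u w"
      unfolding bidisc_series_def infsum_cmult_right'[symmetric]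
      by (rule infsum_cong) (auto simp: power_add mult_ac)
    finally show ?thesis .
  qed
  then show ?thesis
    using True w by (simp add: hartogs_series_def power_divide power_add)
qed (simp add: hartogs_series_def)

lemma mult_z_pow: "(mult_z ^^ k) f (z, w) = z ^ k * f (z, w)"
  by (induction k) (simp_all add: mult_z_def)

lemma mult_w_pow: "(mult_w ^^ k) f (z, w) = w ^ k * f (z, w)"
  by (induction k) (simp_all add: mult_w_def)

lemma mult_pow_hartogs_series:
  "(mult_z ^^ k) ((mult_w ^^ l) (hartogs_series a)) = hartogs_series (shift_coeffs k l a)"
  by (auto simp: fun_eq_iff mult_z_pow mult_w_pow hartogs_series_shift)

section \<open>Orthogonal orbits in the Hardy space\<close>

abbreviation hardy_orbit :: "nat \<Rightarrow> nat \<Rightarrow> (complex \<times> complex \<Rightarrow> complex) \<Rightarrow> complex \<times> complex \<Rightarrow> complex" where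
  "hardy_orbit k l f \<equiv> (mult_z ^^ k) ((mult_w ^^ l) f)"

lemma hardy_orbit_mem:
  assumes "f \<in> hardy_space"
  shows "hardy_orbit k l f \<in> hardy_space"
proof -
  obtain a where "square_summable a" "f = hartogs_series a" using assms by (metis hardy_space_expansion)
  then show ?thesis
    by (simp add: mult_pow_hartogs_series hartogs_series_in_hardy_space square_summable_shift)
qed

lemma hardy_inner_orbit:
  assumes "f \<in> hardy_space" "g \<in> hardy_space"
  shows "hardy_inner (hardy_orbit k l f) (hardy_orbit k l g) = hardy_inner f g"
proof -
  obtain a b where "square_summable a" "f = hartogs_series a" "square_summable b" "g = hartogs_series b"
    using assms by (metis hardy_space_expansion)
  then show ?thesis
    by (simp add: mult_pow_hartogs_series hardy_inner_hartogs_series square_summable_shift l2_inner_shift)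
qed

text \<open>The coefficients of \<open>z\<^sup>k w\<^sup>l g\<close> with second index below \<open>k + l\<close> vanish, so a vector of this form for
  arbitrarily large \<open>k + l\<close> has no nonzero coefficient.\<close>

lemma hardy_orbit_pure:
  assumes mem: "\<And>n. f \<in> hardy_orbit (k n) (l n) ` hardy_space" and grow: "\<And>n. n \<le> k n + l n"
  shows "f = 0"
proof -
  obtain g where "g \<in> hardy_space" "f = hardy_orbit (k 0) (l 0) g" using mem by blast
  then have "f \<in> hardy_space" by (simp add: hardy_orbit_mem)
  then obtain a where a: "square_summable a" "f = hartogs_series a" by (metis hardy_space_expansion)
  have "a (i, j) = 0" for i j
  proof -
    let ?n = "Suc j"
    obtain g where g: "g \<in> hardy_space" "f = hardy_orbit (k ?n) (l ?n) g" using mem by blast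
    then obtain b where b: "square_summable b" "g = hartogs_series b" by (metis hardy_space_expansion)
    let ?b = "shift_coeffs (k ?n) (l ?n) b"
    have s: "square_summable ?b" "square_summable (a - ?b)"
      using a b by (auto intro: square_summable_shift square_summable_diff)
    have "hartogs_series (a - ?b) = hartogs_series a - hartogs_series ?b"
      using a s by (intro hartogs_series_diff)
    also have "\<dots> = hartogs_series 0"
      using a b g by (simp add: mult_pow_hartogs_series hartogs_series_zero)
    finally have "hardy_norm (hartogs_series (a - ?b)) = hardy_norm (hartogs_series 0)" by simp
    then have "(\<Sum>\<^sub>\<infinity>p. (cmod ((a - ?b) p))\<^sup>2) = 0"
      using s by (simp add: hardy_norm_hartogs_series square_summable_def zero_fun_apply)
    then have "a - ?b = 0" using s by (intro square_summable_eq_zero)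
    then have "a = ?b" by simp
    moreover have "?b (i, j) = 0" using grow[of ?n] by (simp add: shift_coeffs_def)
    ultimately show ?thesis by simp
  qed
  then have "a = 0" by (simp add: fun_eq_iff zero_fun_apply split_paired_all)
  then show ?thesis using a by (simp add: hartogs_series_zero)
qed

lemma large_coefficient_box:
  assumes a: "square_summable a" "a \<noteq> 0"
  shows "\<exists>n0. \<forall>n\<ge>n0.
    (\<Sum>\<^sub>\<infinity>p. (cmod (a p))\<^sup>2) / 2 < (\<Sum>p\<in>{..<n} \<times> {..<n}. (cmod (a p))\<^sup>2)"
proof -
  let ?N = "\<Sum>\<^sub>\<infinity>p. (cmod (a p))\<^sup>2"
  have sa: "(\<lambda>p. (cmod (a p))\<^sup>2) summable_on UNIV" using a by (simp add: square_summable_def)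
  have "?N \<noteq> 0" using a square_summable_eq_zero by blast
  moreover have "0 \<le> ?N" by (rule infsum_nonneg) auto
  ultimately have "\<not> ?N \<le> ?N / 2" by simp
  then obtain F where F: "finite F" "\<not> (\<Sum>p\<in>F. (cmod (a p))\<^sup>2) \<le> ?N / 2"
    using infsum_le_finite_sums[OF sa, of "?N / 2"] by blast
  obtain n0 where n0: "F \<subseteq> {..<n0} \<times> {..<n0}" using finite_subset_box[OF F(1)] by blast
  show ?thesis
  proof (intro exI allI impI)
    fix n assume "n0 \<le> n"
    then have "F \<subseteq> {..<n} \<times> {..<n}" using n0 by force
    then have "(\<Sum>p\<in>F. (cmod (a p))\<^sup>2) \<le> (\<Sum>p\<in>{..<n} \<times> {..<n}. (cmod (a p))\<^sup>2)"
      by (intro sum_mono2) auto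
    then show "?N / 2 < (\<Sum>p\<in>{..<n} \<times> {..<n}. (cmod (a p))\<^sup>2)" using F(2) by simp
  qed
qed

text \<open>Bessel's inequality for the unit vector \<open>e\<close> of the coefficient \<open>(K, 2 K)\<close> fails: each of the two
  orbits accounts for more than half of its squared norm.\<close>

theorem orthogonal_orbits_impossible:
  assumes f: "f \<in> hardy_space" "f \<noteq> 0" and g: "g \<in> hardy_space" "g \<noteq> 0"
    and ff: "\<And>i j k l. (i, j) \<noteq> (k, l) \<Longrightarrow> hardy_inner (hardy_orbit i j f) (hardy_orbit k l f) = 0"
    and gg: "\<And>i j k l. (i, j) \<noteq> (k, l) \<Longrightarrow> hardy_inner (hardy_orbit i j g) (hardy_orbit k l g) = 0"
    and fg: "\<And>i j k l. hardy_inner (hardy_orbit i j f) (hardy_orbit k l g) = 0"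
  shows False
proof -
  obtain a where a: "square_summable a" "f = hartogs_series a" using f by (metis hardy_space_expansion)
  obtain b where b: "square_summable b" "g = hartogs_series b" using g by (metis hardy_space_expansion)
  have nz: "a \<noteq> 0" "b \<noteq> 0" using f g a b by (auto simp: hartogs_series_zero)
  have nsq: "hardy.nsq f = (\<Sum>\<^sub>\<infinity>p. (cmod (a p))\<^sup>2)" "hardy.nsq g = (\<Sum>\<^sub>\<infinity>p. (cmod (b p))\<^sup>2)"
    using a b by (simp_all add: hardy.nsq_def hardy_inner_self)
  have pos: "0 < hardy.nsq f" "0 < hardy.nsq g" using f g by (auto intro: hardy.nsq_pos)
  obtain m where m: "\<And>n. m \<le> n \<Longrightarrow> hardy.nsq f / 2 < (\<Sum>p\<in>{..<n} \<times> {..<n}. (cmod (a p))\<^sup>2)"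
    using large_coefficient_box[OF a(1) nz(1)] unfolding nsq by blast
  obtain n where n: "\<And>k. n \<le> k \<Longrightarrow> hardy.nsq g / 2 < (\<Sum>p\<in>{..<k} \<times> {..<k}. (cmod (b p))\<^sup>2)"
    using large_coefficient_box[OF b(1) nz(2)] unfolding nsq by blast
  define K where "K = max m n"
  define I where "I = (UNIV :: bool set) \<times> ({..<K} \<times> {..<K})"
  \<comment> \<open>The exponents are those that move the coefficient at \<open>(p, q)\<close> to \<open>(K, 2 K)\<close>. The
    second coordinate \<open>2 K\<close> keeps the exponent \<open>K + p - q\<close> of \<open>w\<close> nonnegative.\<close>
  define y where "y = (\<lambda>(c, p, q). hardy_orbit (K - p) (K + p - q) (if c then f else g))"
  define \<delta> :: "nat \<times> nat \<Rightarrow> complex" where "\<delta> = (\<lambda>p. if p = (K, 2 * K) then 1 else 0)"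
  have delta_sum: "(\<Sum>\<^sub>\<infinity>p. (if p = (K, 2 * K) then x p else 0)) = x (K, 2 * K)" for x :: "nat \<times> nat \<Rightarrow> 'z :: banach"
    using infsum_cong_neutral[of "{(K, 2 * K)}" UNIV x "\<lambda>p. if p = (K, 2 * K) then x p else 0"] by simp
  have \<delta>: "square_summable \<delta>"
    unfolding square_summable_def \<delta>_def
    by (rule finite_nonzero_values_imp_summable_on) (auto intro: finite_subset[of _ "{(K, 2 * K)}"])
  define e where "e = hartogs_series \<delta>"
  have e: "e \<in> hardy_space" using \<delta> by (simp add: e_def hartogs_series_in_hardy_space)
  have "hardy.nsq e = (\<Sum>\<^sub>\<infinity>p. (cmod (\<delta> p))\<^sup>2)"
    using \<delta> by (simp add: hardy.nsq_def e_def hardy_inner_self)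
  also have "\<dots> = (\<Sum>\<^sub>\<infinity>p. if p = (K, 2 * K) then 1 else 0)"
    by (rule infsum_cong) (simp add: \<delta>_def)
  finally have nsq_e: "hardy.nsq e = 1" by (simp add: delta_sum)
  have coeff: "hardy_inner e (hartogs_series c) = cnj (c (K, 2 * K))" if "square_summable c" for c
  proof -
    have "hardy_inner e (hartogs_series c) = (\<Sum>\<^sub>\<infinity>p. \<delta> p * cnj (c p))"
      using \<delta> that by (simp add: e_def hardy_inner_hartogs_series l2_inner_def)
    also have "\<dots> = (\<Sum>\<^sub>\<infinity>p. if p = (K, 2 * K) then cnj (c p) else 0)"
      by (rule infsum_cong) (simp add: \<delta>_def)
    finally show ?thesis by (simp add: delta_sum)
  qed
  have y_inner: "(cmod (hardy_inner e (y (c, p))))\<^sup>2 = (cmod ((if c then a else b) p))\<^sup>2"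
    if "p \<in> {..<K} \<times> {..<K}" for c p
  proof -
    obtain i j where p: "p = (i, j)" "i < K" "j < K" using \<open>p \<in> _\<close> by auto
    have "y (c, p) = hartogs_series (shift_coeffs (K - i) (K + i - j) (if c then a else b))"
      by (simp add: y_def p a b mult_pow_hartogs_series)
    moreover have "shift_coeffs (K - i) (K + i - j) d (K, 2 * K) = d (i, j)" for d
      using p by (simp add: shift_coeffs_def)
    ultimately show ?thesis
      using a b p by (simp add: coeff square_summable_shift)
  qed
  have nsq_y: "hardy.nsq (y (c, p)) = hardy.nsq (if c then f else g)" for c p
    using f g by (cases p) (simp add: y_def hardy.nsq_def hardy_inner_orbit)
  have gf: "hardy_inner (hardy_orbit i j g) (hardy_orbit k l f) = 0" for i j k l
    using hardy.ip_commute[OF hardy_orbit_mem[OF f(1)] hardy_orbit_mem[OF g(1)]] fg by simp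
  have "(\<Sum>x\<in>I. (cmod (hardy_inner e (y x)))\<^sup>2 / hardy.nsq (y x)) \<le> hardy.nsq e"
  proof (rule hardy.bessel)
    show "finite I" by (simp add: I_def)
    show "y x \<in> hardy_space" for x
      using f g by (auto simp: y_def hardy_orbit_mem split: prod.split)
    show "0 < hardy.nsq (y x)" for x
      using nsq_y[of "fst x" "snd x"] pos by (simp split: if_splits)
    show "hardy_inner (y x) (y x') = 0" if "x \<in> I" "x' \<in> I" "x \<noteq> x'" for x x'
    proof -
      obtain c i j c' i' j' where x: "x = (c, i, j)" "x' = (c', i', j')" by (metis prod.exhaust)
      have ij: "i < K" "j < K" "i' < K" "j' < K" using that by (auto simp: I_def x)
      have "c = c' \<Longrightarrow> (K - i, K + i - j) \<noteq> (K - i', K + i' - j')"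
        using ij that(3) by (auto simp: x)
      then show ?thesis
        by (cases c; cases c') (auto simp: x y_def fg gf intro: ff gg)
    qed
    show "e \<in> hardy_space" by (rule e)
  qed
  also have "(\<Sum>x\<in>I. (cmod (hardy_inner e (y x)))\<^sup>2 / hardy.nsq (y x)) =
      (\<Sum>p\<in>{..<K} \<times> {..<K}. (cmod (a p))\<^sup>2) / hardy.nsq f + (\<Sum>p\<in>{..<K} \<times> {..<K}. (cmod (b p))\<^sup>2) / hardy.nsq g"
  proof -
    have "(\<Sum>x\<in>I. (cmod (hardy_inner e (y x)))\<^sup>2 / hardy.nsq (y x)) =
        (\<Sum>c\<in>UNIV. \<Sum>p\<in>{..<K} \<times> {..<K}. (cmod ((if c then a else b) p))\<^sup>2 / hardy.nsq (if c then f else g))"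
      unfolding I_def sum.cartesian_product'
      by (intro sum.cong refl) (simp add: y_inner nsq_y)
    then show ?thesis by (simp add: UNIV_bool sum_divide_distrib)
  qed
  finally have "(\<Sum>p\<in>{..<K} \<times> {..<K}. (cmod (a p))\<^sup>2) / hardy.nsq f +
      (\<Sum>p\<in>{..<K} \<times> {..<K}. (cmod (b p))\<^sup>2) / hardy.nsq g \<le> 1" by (simp add: nsq_e)
  moreover have "1 / 2 < (\<Sum>p\<in>{..<K} \<times> {..<K}. (cmod (a p))\<^sup>2) / hardy.nsq f"
    using m[of K] pos by (simp add: K_def field_simps)
  moreover have "1 / 2 < (\<Sum>p\<in>{..<K} \<times> {..<K}. (cmod (b p))\<^sup>2) / hardy.nsq g"
    using n[of K] pos by (simp add: K_def field_simps)
  ultimately show False by linarith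
qed

section \<open>Doubly commuting submodules\<close>

lemma mult_linear:
  "mult_z (f + g) = mult_z f + mult_z g" "mult_z (fun_scale c f) = fun_scale c (mult_z f)"
  "mult_w (f + g) = mult_w f + mult_w g" "mult_w (fun_scale c f) = fun_scale c (mult_w f)"
  by (auto simp: mult_z_def mult_w_def fun_scale_def fun_eq_iff plus_fun_apply algebra_simps)

text \<open>Closedness is phrased with approximations in the Hardy norm; these follow from
  convergence of the squared norms.\<close>

lemma submodule_function_hilbert:
  assumes S: "submodule S"
  shows "function_hilbert S hardy_inner"
proof (rule hardy.closed_subspace)
  show "cfun.subspace S" "S \<subseteq> hardy_space" using S by (auto simp: submodule_def)
  fix x X assume x: "x \<in> hardy_space" and X: "\<And>n. X n \<in> S" and lim: "(\<lambda>n. hardy.nsq (X n - x)) \<longlonglongrightarrow> 0"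
  have "\<exists>g\<in>S. hardy_norm (x - g) < e" if "0 < e" for e
  proof -
    have "\<forall>\<^sub>F n in sequentially. hardy.nsq (X n - x) < e\<^sup>2"
      using that by (intro order_tendstoD(2)[OF lim]) simp
    then obtain n where n: "hardy.nsq (X n - x) < e\<^sup>2" by (auto simp: eventually_sequentially)
    have XH: "X n \<in> hardy_space" using X S by (auto simp: submodule_def)
    have "hardy_norm (x - X n) = sqrt (hardy.nsq (X n - x))"
      using x XH by (simp add: hardy_norm_eq hardy.diff_mem hardy.nsq_commute)
    also have "\<dots> < e" using n that by (intro real_less_lsqrt) auto
    finally show ?thesis using X by blast
  qed
  then have "x \<in> hardy_closure S" using x by (auto simp: hardy_closure_def)
  then show "x \<in> S" using S by (simp add: submodule_def)
qed

lemma hardy_closure_mono: "A \<subseteq> B \<Longrightarrow> hardy_closure A \<subseteq> hardy_closure B"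
  by (fastforce simp: hardy_closure_def)

lemma hardy_closure_zero: "hardy_closure {0} = {0}"
proof -
  have "f = 0" if f: "f \<in> hardy_space" and small: "\<And>e. 0 < e \<Longrightarrow> hardy_norm f < e" for f
  proof (rule ccontr)
    assume "f \<noteq> 0"
    then have "0 < hardy_norm f" using f by (simp add: hardy_norm_eq hardy.nsq_pos)
    then show False using small by blast
  qed
  moreover have "hardy_norm 0 = 0" by (simp add: hardy_norm_eq hardy.zero_mem hardy.nsq_def hardy.ip_zero_left)
  ultimately show ?thesis using hardy.zero_mem by (auto simp: hardy_closure_def)
qed

text \<open>The adjoints are definite descriptions, which \<open>isometry_adjoint_exists\<close> justifies; only then does
  the hypothesis of double commutativity speak about actual adjoints.\<close>

theorem doubly_commuting_shifts_of_submodule: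
  assumes S: "submodule S" and dc: "doubly_commuting S"
  shows "doubly_commuting_shifts S hardy_inner mult_z mult_w (adjoint_on S mult_z) (adjoint_on S mult_w)"
proof -
  interpret S: function_hilbert S hardy_inner using S by (rule submodule_function_hilbert)
  have SH: "S \<subseteq> hardy_space" and inv: "\<And>f. f \<in> S \<Longrightarrow> mult_z f \<in> S" "\<And>f. f \<in> S \<Longrightarrow> mult_w f \<in> S"
    using S by (auto simp: submodule_def)
  have iso: "hardy_inner (mult_z f) (mult_z g) = hardy_inner f g"
    "hardy_inner (mult_w f) (mult_w g) = hardy_inner f g" if "f \<in> S" "g \<in> S" for f g
    using hardy_inner_orbit[of f g 1 0] hardy_inner_orbit[of f g 0 1] that SH by auto
  have z: "adjoint_on S mult_z g \<in> S \<and> (\<forall>f\<in>S. hardy_inner (mult_z f) g = hardy_inner f (adjoint_on S mult_z g))"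
    if "g \<in> S" for g
  proof -
    have "\<exists>!h. h \<in> S \<and> (\<forall>f\<in>S. hardy_inner (mult_z f) g = hardy_inner f h)"
      by (rule S.isometry_adjoint_exists) (simp_all add: inv iso mult_linear that)
    from theI'[OF this] show ?thesis unfolding adjoint_on_def .
  qed
  have w: "adjoint_on S mult_w g \<in> S \<and> (\<forall>f\<in>S. hardy_inner (mult_w f) g = hardy_inner f (adjoint_on S mult_w g))"
    if "g \<in> S" for g
  proof -
    have "\<exists>!h. h \<in> S \<and> (\<forall>f\<in>S. hardy_inner (mult_w f) g = hardy_inner f h)"
      by (rule S.isometry_adjoint_exists) (simp_all add: inv iso mult_linear that)
    from theI'[OF this] show ?thesis unfolding adjoint_on_def .
  qed
  show ?thesis
  proof
    show "f = 0" if f: "\<And>n. f \<in> (mult_z ^^ n) ` S" for f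
    proof (rule hardy_orbit_pure[where k = "\<lambda>n. n" and l = "\<lambda>n. 0"])
      show "f \<in> hardy_orbit n 0 ` hardy_space" for n using f[of n] SH by auto
    qed simp
    show "f = 0" if f: "\<And>n. f \<in> (mult_w ^^ n) ` S" for f
    proof (rule hardy_orbit_pure[where k = "\<lambda>n. 0" and l = "\<lambda>n. n"])
      show "f \<in> hardy_orbit 0 n ` hardy_space" for n using f[of n] SH by auto
    qed simp
    show "mult_z (mult_w f) = mult_w (mult_z f)" for f
      by (auto simp: mult_z_def mult_w_def fun_eq_iff)
    show "adjoint_on S mult_z (mult_w f) = mult_w (adjoint_on S mult_z f)" if "f \<in> S" for f
      using dc that by (auto simp: doubly_commuting_def)
  qed (use inv iso z w in auto)
qed

theorem corollary2p5:
  fixes S :: "(complex \<times> complex \<Rightarrow> complex) set"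
  assumes "submodule S" and "S \<noteq> {0}" and "doubly_commuting S"
  shows "submodule_rank S = 1"
proof -
  interpret S: doubly_commuting_shifts S hardy_inner mult_z mult_w "adjoint_on S mult_z" "adjoint_on S mult_w"
    using assms(1,3) by (rule doubly_commuting_shifts_of_submodule)
  have SH: "S \<subseteq> hardy_space" and closed: "hardy_closure S = S" using assms(1) by (auto simp: submodule_def)
  obtain x where x: "x \<in> S" "x \<noteq> 0" using assms(2) S.zero_mem by blast
  obtain f where f: "f \<in> S" "f \<noteq> 0" "S.wandering f"
    using S.wandering_exists[of S, OF _ _ _ _ _ _ x] S.diff_mem S.V_mem S.W_mem S.Vs_mem S.Ws_mem by blast
  have unique: "g = 0" if g: "S.wandering g" and gf: "hardy_inner g f = 0" for g
  proof (rule ccontr)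
    assume "g \<noteq> 0"
    have gS: "g \<in> S" using g by (simp add: S.wandering_def)
    have fg: "hardy_inner f g = 0" using S.ip_commute[OF gS f(1)] gf by simp
    show False
    proof (rule orthogonal_orbits_impossible[of f g])
      show "f \<in> hardy_space" "g \<in> hardy_space" "f \<noteq> 0" "g \<noteq> 0"
        using f(1,2) gS SH \<open>g \<noteq> 0\<close> by auto
      show "hardy_inner (S.orbit i j f) (S.orbit k l f) = 0" if "(i, j) \<noteq> (k, l)" for i j k l
        using S.orbits_orthogonal[OF f(3) f(3)] that by blast
      show "hardy_inner (S.orbit i j g) (S.orbit k l g) = 0" if "(i, j) \<noteq> (k, l)" for i j k l
        using S.orbits_orthogonal[OF g g] that by blast
      show "hardy_inner (S.orbit i j f) (S.orbit k l g) = 0" for i j k l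
        using S.orbits_orthogonal[OF f(3) g] fg by blast
    qed
  qed
  have orbit: "{(mult_z ^^ k1) ((mult_w ^^ k2) h) | k1 k2 h. h \<in> {f}} = {S.orbit i j f | i j. True}" by auto
  have span: "cfun.span {S.orbit i j f | i j. True} \<subseteq> S"
    using S.orbit_mem[OF f(1)] by (intro cfun.span_minimal S.subspace) auto
  have "generated mult_z mult_w {f} = S"
  proof
    have "generated mult_z mult_w {f} \<subseteq> hardy_closure S"
      unfolding generated_def orbit by (rule hardy_closure_mono[OF span])
    then show "generated mult_z mult_w {f} \<subseteq> S" by (simp only: closed)
    show "S \<subseteq> generated mult_z mult_w {f}"
    proof
      fix x assume xS: "x \<in> S"
      obtain X where X: "\<And>n. X n \<in> cfun.span {S.orbit i j f | i j. True}" "(\<lambda>n. S.nsq (X n - x)) \<longlonglongrightarrow> 0"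
        using S.orbit_span_dense[OF f(3) unique xS] by blast
      have "\<exists>h\<in>cfun.span {S.orbit i j f | i j. True}. hardy_norm (x - h) < e" if "0 < e" for e
      proof -
        have "\<forall>\<^sub>F n in sequentially. S.nsq (X n - x) < e\<^sup>2"
          using that by (intro order_tendstoD(2)[OF X(2)]) simp
        then obtain n where n: "S.nsq (X n - x) < e\<^sup>2" by (auto simp: eventually_sequentially)
        have XS: "X n \<in> S" using X(1) span by blast
        have "hardy_norm (x - X n) = sqrt (S.nsq (X n - x))"
          using xS XS SH S.nsq_commute[OF xS XS]
          by (simp add: hardy_norm_eq hardy.diff_mem subsetD S.nsq_def hardy.nsq_def)
        also have "\<dots> < e" using n that by (intro real_less_lsqrt) auto
        finally show ?thesis using X(1) by blast
      qed
      then show "x \<in> generated mult_z mult_w {f}"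
        using xS SH unfolding generated_def orbit by (auto simp: hardy_closure_def)
    qed
  qed
  then have "submodule_rank S \<le> (if finite {f} then enat (card {f}) else \<infinity>)"
    unfolding submodule_rank_def joint_rank_def using f(1) by (intro INF_lower) auto
  then have "submodule_rank S \<le> 1" by (simp add: one_enat_def)
  \<comment> \<open>The empty set generates only \<open>{0}\<close>.\<close>
  moreover have "1 \<le> submodule_rank S"
    unfolding submodule_rank_def joint_rank_def
  proof (rule INF_greatest)
    fix E assume E: "E \<in> {E. E \<subseteq> S \<and> generated mult_z mult_w E = S}"
    have "E \<noteq> {}"
    proof
      assume "E = {}"
      then have "generated mult_z mult_w E = {0}"
        by (simp add: generated_def cfun.span_empty hardy_closure_zero)
      then show False using E assms(2) by simp
    qed
    then show "1 \<le> (if finite E then enat (card E) else \<infinity>)"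
      by (auto simp: one_enat_def Suc_le_eq card_gt_0_iff)
  qed
  ultimately show ?thesis by (rule antisym)
qed

end
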